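(* Let $V$ denote a finite-dimensional irreducible $U^{\ge 0}$-module of type $\alpha=(\alpha_i)_{i=1}^n$. Let $\varepsilon=(\varepsilon_i)_{i=1}^n \in \{1, -1\}^n$. Then there exists a unique $U_q(\mathfrak{g})$-module structure on $V$ such that the operators $E_i - \varepsilon_i \alpha_i^{-1} e_i$ and $K_i^{\pm 1} - \varepsilon_i \alpha_i^{\mp 1}k_i^{\pm 1}$ vanish on $V$ for $1 \le i \le n$. This $U_q(\mathfrak{g})$-module structure is irreducible and of type $\varepsilon$.
   Context: $\mathbb{F}$ is an algebraically closed field of characteristic $0$, $\mathbb{F}^\times=\mathbb{F}\setminus\{0\}$, and $q\in\mathbb{F}^\times$ is not a root of unity. $A=(A_{ij})$ is a symmetrizable generalized Cartan matrix of order $n$ and affine type (in the sense of Kac: indecomposable, of corank 1, with $Au=0$ for some column vector $u$ with positive entries). $s_1,\dots,s_n$ are relatively prime positive integers with $s_iA_{ij}=s_jA_{ji}$ for all $i,j$; put $q_i=q^{s_i}$, $[m]_i=\frac{q_i^m-q_i^{-m}}{q_i-q_i^{-1}}$, $[m]_i^!=[m]_i[m-1]_i\cdots[1]_i$ with $[0]_i^!=1$, and $\begin{bmatrix} m\\ r\end{bmatrix}_i=\frac{[m]_i^!}{[r]_i^![m-r]_i^!}$ for integers $m\ge r\ge 0$. $\mathfrak{g}=\mathfrak{g}'(A)$ is the Kac-Moody algebra over $\mathbb{C}$ of $A$. $U_q(\mathfrak{g})$ is the unital associative $\mathbb{F}$-algebra with generators $E_i,F_i,K_i^{\pm1}$ ($1\le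 i\le n$) and relations: $K_iK_i^{-1}=K_i^{-1}K_i=1$; $K_iK_j=K_jK_i$; $K_iE_jK_i^{-1}=q_i^{A_{ij}}E_j$; $K_iF_jK_i^{-1}=q_i^{-A_{ij}}F_j$; $E_iF_j-F_jE_i=\delta_{ij}\frac{K_i-K_i^{-1}}{q_i-q_i^{-1}}$; and, for $i\ne j$, $\sum_{r=0}^{1-A_{ij}}(-1)^r\begin{bmatrix}1-A_{ij}\\ r\end{bmatrix}_iE_i^{1-A_{ij}-r}E_jE_i^r=0$ and the same relation with every $E$ replaced by $F$. $U^{\ge0}$ is the unital associative $\mathbb{F}$-algebra with generators $e_i,k_i^{\pm1}$ ($1\le i\le n$) and relations: $k_ik_i^{-1}=k_i^{-1}k_i=1$; $k_ik_j=k_jk_i$; $k_ie_jk_i^{-1}=q_i^{A_{ij}}e_j$; and, for $i\ne j$, $\sum_{r=0}^{1-A_{ij}}(-1)^r\begin{bmatrix}1-A_{ij}\\ r\end{bmatrix}_ie_i^{1-A_{ij}-r}e_je_i^r=0$. Type of a $U_q(\mathfrak{g})$-module: for a finite-dimensional irreducible $U_q(\mathfrak{g})$-module $V$, each $K_i$ acts semisimply and there are $\varepsilon_i\in\{1,-1\}$ such that every eigenvalue of $K_i$ on $V$ is of the form $\varepsilon_iq_i^m$ ($m\in\mathbb{Z}$); $(\varepsilon_i)_{i=1}^n$ is the type of $V$. Type of a $U^{\ge0}$-module: for a finite-dimensional irreducible $U^{\ge0}$-module $V$, each $k_i$ acts semisimply and there are scalars $\alpha_i\in\mathbb{F}^\times$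 such that the set of distinct eigenvalues of $k_i$ on $V$ is $\alpha_i\Delta_i$, where $\Delta_i\subseteq\{q_i^m\mid m\in\mathbb{Z}\}$ and $\Delta_i=\{\theta^{-1}\mid\theta\in\Delta_i\}$; $(\alpha_i)_{i=1}^n$ is the type of $V$. *)

theory Defs
  imports
    "HOL-Analysis.Analysis"
    "HOL-Library.Poly_Mapping"
    "HOL-Algebra.QuotRing"
    "HOL-Algebra.Algebraic_Closure_Type"
begin

section \<open>Affine generalized Cartan matrices\<close>

text \<open>The rows and columns are indexed by a finite type \<open>'n\<close>; the order of the matrix is
  \<open>CARD('n)\<close>.\<close>

definition gcm :: "int^'n^'n::finite \<Rightarrow> bool" where
  "gcm A \<longleftrightarrow> (\<forall>i. A $ i $ i = 2) \<and> (\<forall>i j. i \<noteq> j \<longrightarrow> A $ i $ j \<le> 0)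
     \<and> (\<forall>i j. A $ i $ j = 0 \<longrightarrow> A $ j $ i = 0)"

definition indecomposable :: "int^'n^'n::finite \<Rightarrow> bool" where
  "indecomposable A \<longleftrightarrow>
     \<not> (\<exists>S. S \<noteq> {} \<and> S \<noteq> UNIV \<and> (\<forall>i\<in>S. \<forall>j\<in>-S. A $ i $ j = 0 \<and> A $ j $ i = 0))"

definition affine_gcm :: "int^'n^'n::finite \<Rightarrow> bool" where
  "affine_gcm A \<longleftrightarrow> gcm A \<and> indecomposable A
     \<and> rank (map_matrix real_of_int A) + 1 = CARD('n)
     \<and> (\<exists>u :: real^'n. (\<forall>i. u $ i > 0) \<and> map_matrix real_of_int A *v u = 0)"

text \<open>The existence of \<open>s\<close> below says that \<open>A\<close> is symmetrizable.\<close>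

definition symmetrizing :: "int^'n^'n::finite \<Rightarrow> ('n \<Rightarrow> nat) \<Rightarrow> bool" where
  "symmetrizing A s \<longleftrightarrow> (\<forall>i. s i > 0) \<and> Gcd (range s) = 1
     \<and> (\<forall>i j. int (s i) * A $ i $ j = int (s j) * A $ j $ i)"

section \<open>Quantum integers\<close>

text \<open>These are applied with \<open>p = q ^ s i\<close>.\<close>

definition qint :: "'f::field \<Rightarrow> nat \<Rightarrow> 'f" where
  "qint p m = (p ^ m - inverse p ^ m) / (p - inverse p)"

definition qfact :: "'f::field \<Rightarrow> nat \<Rightarrow> 'f" where
  "qfact p m = (\<Prod>k = 1..m. qint p k)"

definition qbinom :: "'f::field \<Rightarrow> nat \<Rightarrow> nat \<Rightarrow> 'f" where
  "qbinom p m r = qfact p m / (qfact p r * qfact p (m - r))"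

section \<open>Algebras presented by generators and relations\<close>

text \<open>The free unital associative algebra over \<open>'f\<close> on the set of generators \<open>'g\<close> is the monoid
  algebra of the free monoid of words in \<open>'g\<close>. The monoid is written additively because
  \<^typ>\<open>'a \<Rightarrow>\<^sub>0 'b\<close> carries the convolution product for additively written monoids.\<close>

datatype 'g word = Word (letters: "'g list")

instantiation word :: (type) monoid_add
begin

definition zero_word :: "'a word" where
  "zero_word = Word []"

definition plus_word :: "'a word \<Rightarrow> 'a word \<Rightarrow> 'a word" where
  "plus_word x y = Word (letters x @ letters y)"

instance
  by standard (simp_all add: zero_word_def plus_word_def)

end

type_synonym ('g, 'f) free_alg = "'g word \<Rightarrow>\<^sub>0 'f"

definition gen :: "'g \<Rightarrow> ('g, 'f::field) free_alg" where
  "gen g = Poly_Mapping.single (Word [g]) 1"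

definition scalar :: "'f::field \<Rightarrow> ('g, 'f) free_alg" where
  "scalar c = Poly_Mapping.single 0 c"

abbreviation free_ring :: "('g, 'f::field) free_alg ring" where
  "free_ring \<equiv> ring_of_type_algebra"

lemma ring_free_ring: "ring (free_ring :: ('g, 'f::field) free_alg ring)"
proof -
  have "\<exists>y. x + y = 0" for x :: "('g, 'f) free_alg"
    using add.right_inverse by blast
  then show ?thesis
    unfolding ring_of_type_algebra_def using add.right_inverse
    by unfold_locales (auto simp: algebra_simps Units_def)
qed

text \<open>The algebra generated by \<open>'g\<close> subject to the relations \<open>r = 0\<close> for \<open>r \<in> R\<close>, where
  \<^const>\<open>genideal\<close> gives the two-sided ideal generated by \<open>R\<close>, and the image of an element of
  the free algebra in it.\<close>

definition presented :: "('g, 'f::field) free_alg set \<Rightarrow> ('g, 'f) free_alg set ring" where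
  "presented R = free_ring Quot (genideal free_ring R)"

definition cls :: "('g, 'f::field) free_alg set \<Rightarrow> ('g, 'f) free_alg \<Rightarrow> ('g, 'f) free_alg set" where
  "cls R x = genideal free_ring R +>\<^bsub>free_ring\<^esub> x"

lemma ring_presented: "ring (presented R)"
  unfolding presented_def
  by (intro ideal.quotient_is_ring ring.genideal_ideal ring_free_ring)
     (simp add: ring_of_type_algebra_def)

section \<open>Modules\<close>

definition End_ring :: "('f::field \<Rightarrow> 'v \<Rightarrow> 'v::ab_group_add) \<Rightarrow> ('v \<Rightarrow> 'v) ring" where
  "End_ring sc =
     \<lparr>carrier = {f. Vector_Spaces.linear sc sc f}, monoid.mult = (\<circ>), one = id,
      ring.zero = (\<lambda>v. 0), add = (\<lambda>f g v. f v + g v)\<rparr>"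

text \<open>A structure of a left module over the algebra \<^term>\<open>presented R\<close> on the vector space \<open>'v\<close>
  with scalar multiplication \<open>sc\<close>, given as a homomorphism of unital \<open>'f\<close>-algebras to the
  endomorphism algebra. Values outside the algebra are fixed by extensionality, so that equality of
  the functions \<open>\<rho>\<close> is equality of module structures.\<close>

definition module_structure ::
  "('f::field \<Rightarrow> 'v \<Rightarrow> 'v::ab_group_add) \<Rightarrow> ('g, 'f) free_alg set \<Rightarrow>
   (('g, 'f) free_alg set \<Rightarrow> 'v \<Rightarrow> 'v) \<Rightarrow> bool" where
  "module_structure sc R \<rho> \<longleftrightarrow>
     \<rho> \<in> ring_hom (presented R) (End_ring sc) \<inter> extensional (carrier (presented R)) \<and>
     (\<forall>c. \<rho> (cls R (scalar c)) = sc c)"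

definition irreducible_structure ::
  "('f::field \<Rightarrow> 'v \<Rightarrow> 'v::ab_group_add) \<Rightarrow> ('g, 'f) free_alg set \<Rightarrow>
   (('g, 'f) free_alg set \<Rightarrow> 'v \<Rightarrow> 'v) \<Rightarrow> bool" where
  "irreducible_structure sc R \<rho> \<longleftrightarrow>
     (UNIV :: 'v set) \<noteq> {0} \<and>
     (\<forall>W. module.subspace sc W \<and> (\<forall>u \<in> carrier (presented R). \<rho> u ` W \<subseteq> W)
        \<longrightarrow> W = {0} \<or> W = UNIV)"

definition eigenvalues :: "('f::field \<Rightarrow> 'v \<Rightarrow> 'v::ab_group_add) \<Rightarrow> ('v \<Rightarrow> 'v) \<Rightarrow> 'f set" where
  "eigenvalues sc f = {\<theta>. \<exists>v. v \<noteq> 0 \<and> f v = sc \<theta> v}"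

text \<open>Over an algebraically closed field, acting semisimply means being diagonalizable.\<close>

definition acts_semisimply :: "('f::field \<Rightarrow> 'v \<Rightarrow> 'v::ab_group_add) \<Rightarrow> ('v \<Rightarrow> 'v) \<Rightarrow> bool" where
  "acts_semisimply sc f \<longleftrightarrow> module.span sc {v. \<exists>\<theta>. f v = sc \<theta> v} = UNIV"

section \<open>The algebras \<open>U\<^sub>q(\<gg>)\<close> and \<open>U\<^sup>\<ge>\<^sup>0\<close>\<close>

definition serre :: "'f::field \<Rightarrow> ('n \<Rightarrow> nat) \<Rightarrow> int^'n^'n::finite \<Rightarrow>
   ('n \<Rightarrow> ('g, 'f) free_alg) \<Rightarrow> 'n \<Rightarrow> 'n \<Rightarrow> ('g, 'f) free_alg" where
  "serre q s A x i j =
     (let m = nat (1 - A $ i $ j) in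
      \<Sum>r = 0..m. scalar ((-1) ^ r * qbinom (q ^ s i) m r) * x i ^ (m - r) * x j * x i ^ r)"

datatype 'n uq_gen = E_gen 'n | F_gen 'n | K_gen 'n | Kinv_gen 'n

definition uq_rels :: "'f::field \<Rightarrow> ('n \<Rightarrow> nat) \<Rightarrow> int^'n^'n::finite \<Rightarrow>
   ('n uq_gen, 'f) free_alg set" where
  "uq_rels q s A =
     {gen (K_gen i) * gen (Kinv_gen i) - 1 | i. True} \<union>
     {gen (Kinv_gen i) * gen (K_gen i) - 1 | i. True} \<union>
     {gen (K_gen i) * gen (K_gen j) - gen (K_gen j) * gen (K_gen i) | i j. True} \<union>
     {gen (K_gen i) * gen (E_gen j) * gen (Kinv_gen i)
        - scalar ((q ^ s i) powi (A $ i $ j)) * gen (E_gen j) | i j. True} \<union>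
     {gen (K_gen i) * gen (F_gen j) * gen (Kinv_gen i)
        - scalar ((q ^ s i) powi (- A $ i $ j)) * gen (F_gen j) | i j. True} \<union>
     {gen (E_gen i) * gen (F_gen j) - gen (F_gen j) * gen (E_gen i)
        - (if i = j
           then scalar (1 / (q ^ s i - inverse (q ^ s i))) * (gen (K_gen i) - gen (Kinv_gen i))
           else 0) | i j. True} \<union>
     {serre q s A (\<lambda>i. gen (E_gen i)) i j | i j. i \<noteq> j} \<union>
     {serre q s A (\<lambda>i. gen (F_gen i)) i j | i j. i \<noteq> j}"

datatype 'n borel_gen = e_gen 'n | k_gen 'n | kinv_gen 'n

definition borel_rels :: "'f::field \<Rightarrow> ('n \<Rightarrow> nat) \<Rightarrow> int^'n^'n::finite \<Rightarrow>
   ('n borel_gen, 'f) free_alg set" where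
  "borel_rels q s A =
     {gen (k_gen i) * gen (kinv_gen i) - 1 | i. True} \<union>
     {gen (kinv_gen i) * gen (k_gen i) - 1 | i. True} \<union>
     {gen (k_gen i) * gen (k_gen j) - gen (k_gen j) * gen (k_gen i) | i j. True} \<union>
     {gen (k_gen i) * gen (e_gen j) * gen (kinv_gen i)
        - scalar ((q ^ s i) powi (A $ i $ j)) * gen (e_gen j) | i j. True} \<union>
     {serre q s A (\<lambda>i. gen (e_gen i)) i j | i j. i \<noteq> j}"

section \<open>Types of modules\<close>

definition uq_type :: "'f::field \<Rightarrow> ('n \<Rightarrow> nat) \<Rightarrow> int^'n^'n::finite \<Rightarrow>
   ('f \<Rightarrow> 'v \<Rightarrow> 'v::ab_group_add) \<Rightarrow> (('n uq_gen, 'f) free_alg set \<Rightarrow> 'v \<Rightarrow> 'v) \<Rightarrow>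
   ('n \<Rightarrow> 'f) \<Rightarrow> bool" where
  "uq_type q s A sc \<rho> \<epsilon> \<longleftrightarrow>
     (\<forall>i. let K\<^sub>i = \<rho> (cls (uq_rels q s A) (gen (K_gen i))) in
        acts_semisimply sc K\<^sub>i \<and> \<epsilon> i \<in> {1, -1} \<and>
        eigenvalues sc K\<^sub>i \<subseteq> {\<epsilon> i * (q ^ s i) powi m | m. True})"

definition borel_type :: "'f::field \<Rightarrow> ('n \<Rightarrow> nat) \<Rightarrow> int^'n^'n::finite \<Rightarrow>
   ('f \<Rightarrow> 'v \<Rightarrow> 'v::ab_group_add) \<Rightarrow> (('n borel_gen, 'f) free_alg set \<Rightarrow> 'v \<Rightarrow> 'v) \<Rightarrow>
   ('n \<Rightarrow> 'f) \<Rightarrow> bool" where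
  "borel_type q s A sc \<rho> \<alpha> \<longleftrightarrow>
     (\<forall>i. let k\<^sub>i = \<rho> (cls (borel_rels q s A) (gen (k_gen i))) in
        acts_semisimply sc k\<^sub>i \<and> \<alpha> i \<noteq> 0 \<and>
        (\<exists>\<Delta>. \<Delta> \<subseteq> {(q ^ s i) powi m | m. True} \<and> \<Delta> = inverse ` \<Delta> \<and>
              eigenvalues sc k\<^sub>i = (\<lambda>\<theta>. \<alpha> i * \<theta>) ` \<Delta>))"

section \<open>Extending a module structure from \<open>U\<^sup>\<ge>\<^sup>0\<close> to \<open>U\<^sub>q(\<gg>)\<close>\<close>

text \<open>\<open>\<rho>\<close> is a \<open>U\<^sub>q(\<gg>)\<close>-module structure on which the operators
  \<open>E\<^sub>i - \<epsilon>\<^sub>i \<alpha>\<^sub>i\<^sup>-\<^sup>1 e\<^sub>i\<close>, \<open>K\<^sub>i - \<epsilon>\<^sub>i \<alpha>\<^sub>i\<^sup>-\<^sup>1 k\<^sub>i\<close>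
  and \<open>K\<^sub>i\<^sup>-\<^sup>1 - \<epsilon>\<^sub>i \<alpha>\<^sub>i k\<^sub>i\<^sup>-\<^sup>1\<close> vanish, the \<open>U\<^sup>\<ge>\<^sup>0\<close>-action being \<open>\<sigma>\<close>.\<close>

definition extends_borel :: "'f::field \<Rightarrow> ('n \<Rightarrow> nat) \<Rightarrow> int^'n^'n::finite \<Rightarrow>
   ('f \<Rightarrow> 'v \<Rightarrow> 'v::ab_group_add) \<Rightarrow> (('n borel_gen, 'f) free_alg set \<Rightarrow> 'v \<Rightarrow> 'v) \<Rightarrow>
   ('n \<Rightarrow> 'f) \<Rightarrow> ('n \<Rightarrow> 'f) \<Rightarrow> (('n uq_gen, 'f) free_alg set \<Rightarrow> 'v \<Rightarrow> 'v) \<Rightarrow> bool" where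
  "extends_borel q s A sc \<sigma> \<alpha> \<epsilon> \<rho> \<longleftrightarrow>
     module_structure sc (uq_rels q s A) \<rho> \<and>
     (let act = (\<lambda>g. \<rho> (cls (uq_rels q s A) (gen g)));
          act0 = (\<lambda>g. \<sigma> (cls (borel_rels q s A) (gen g)))
      in \<forall>i v. act (E_gen i) v - sc (\<epsilon> i * inverse (\<alpha> i)) (act0 (e_gen i) v) = 0 \<and>
               act (K_gen i) v - sc (\<epsilon> i * inverse (\<alpha> i)) (act0 (k_gen i) v) = 0 \<and>
               act (Kinv_gen i) v - sc (\<epsilon> i * \<alpha> i) (act0 (kinv_gen i) v) = 0)"

end

theory Submission
  imports Defs
begin

text \<open>Fix \<open>i\<close> and decompose \<open>V\<close>, as a module graded by the eigenvalues \<open>q\<^sub>i\<^bsup>b\<^esup>\<close> of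
  \<open>K = \<alpha>\<^sub>i\<^sup>-\<^sup>1 k\<^sub>i\<close>, into strings \<open>v, E v, E\<^sup>2 v, \<dots>\<close> of \<open>E = \<epsilon>\<^sub>i \<alpha>\<^sub>i\<^sup>-\<^sup>1 e\<^sub>i\<close>. The span \<open>Fil c\<close> of
  the strings centred at weights at most \<open>c\<close> does not depend on the decomposition. By the Serre
  relation \<open>e\<^sub>j\<close> generates under the adjoint action of \<open>E\<close> a quotient of a string with centre \<open>0\<close>, and
  tensoring a string of centre \<open>c\<close> with one of centre \<open>0\<close> gives a sum of strings of centre \<open>c\<close>.
  Hence \<open>Fil c\<close> is a \<open>U\<^sup>\<ge>\<^sup>0\<close>-submodule, so irreducibility forces all centres to be equal, and the
  symmetry of the set of weights forces them to be \<open>0\<close>. Then there is exactly one operator \<open>F\<close>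
  that completes \<open>E\<close>, \<open>K\<close> to an action of \<open>U\<^sub>q(sl\<^sub>2)\<close>. The other relations of \<open>U\<^sub>q(\<gg>)\<close> assert that
  certain operators vanish; each of these generates under the adjoint action of some \<open>E\<^sub>i\<close> a string
  of negative centre, so it lowers the filtration and is therefore \<open>0\<close>.\<close>

section \<open>Polynomials vanishing on a geometric progression\<close>

text \<open>The obstacle is that no lowering operator exists yet when the strings have to be
  compared, so neither complete reducibility nor a Casimir element of U_q(sl_2) is at hand. The
  filtration by centres uses only E and the weights, and the tensor product of strings becomes a
  computation with polynomials. If x generates a string of at most N + 1 vectors under the twisted
  adjoint action of E, then the vectors E^i x E^k v with i + k = D satisfy the relations of the
  monomials X^i modulo a polynomial of degree N + 1 whose roots form a geometric progression. Its
  ratio q_i^2 is not a root of unity, so any N + 1 of these monomials, not only the lowest ones,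
  express all the others; choosing them well is the Clebsch-Gordan argument. A string of N + 1
  vectors that starts at weight w has centre w + N. The operator E_j starts at A_ij and has 1 - A_ij
  vectors, which gives 0; the commutator of F_i and E_j starts at A_ij - 2 with the same number of
  vectors, which gives -2. Division by \<alpha> makes the eigenvalues of k_i powers of q_i; the
  signs of K_i and F_i are inserted only at the end.\<close>

lemma lagrange_moments:
  fixes y :: "'i \<Rightarrow> 'f::field"
  assumes fin: "finite J" and inj: "inj_on y J" and card: "card J = Suc N"
  shows "\<exists>c. \<forall>t\<le>N. (\<Sum>j\<in>J. c j * y j ^ t) = z ^ t"
proof -
  \<comment> \<open>These are the Lagrange basis polynomials for the nodes \<open>y j\<close>; the
    coefficient \<open>c j\<close> sought is the value of \<open>L j\<close> at z.\<close>
  define L where "L j = (\<Prod>i\<in>J - {j}. Polynomial.smult (inverse (y j - y i)) [:- y i, 1:])" for j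
  have L: "poly (L j) (y k) = (if j = k then 1 else 0)" if "j \<in> J" "k \<in> J" for j k
  proof (cases "j = k")
    case True
    have "poly (L j) (y j) = (\<Prod>i\<in>J - {j}. 1)"
      unfolding L_def poly_prod
    proof (rule prod.cong)
      fix i assume "i \<in> J - {j}"
      then have "y j - y i \<noteq> 0" using inj that by (auto dest: inj_onD)
      then have "inverse (y j - y i) * (y j - y i) = 1" by (rule left_inverse)
      then show "poly (Polynomial.smult (inverse (y j - y i)) [:- y i, 1:]) (y j) = 1"
        by (simp add: algebra_simps)
    qed simp
    then show ?thesis using True by simp
  next
    case False
    then have "k \<in> J - {j}" using that by auto
    then have "poly (L j) (y k) = 0"
      unfolding L_def poly_prod using fin by (intro prod_zero) (auto intro!: bexI[of _ k])
    then show ?thesis using False by simp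
  qed
  have degL: "Polynomial.degree (L j) \<le> N" if "j \<in> J" for j
  proof -
    have "Polynomial.degree (L j) \<le> (\<Sum>i\<in>J - {j}. Polynomial.degree (Polynomial.smult (inverse (y j - y i)) [:- y i, 1:]))"
      using degree_prod_sum_le[of "J - {j}" "\<lambda>i. Polynomial.smult (inverse (y j - y i)) [:- y i, 1:]"] fin
      by (simp add: L_def o_def)
    also have "\<dots> \<le> (\<Sum>i\<in>J - {j}. 1)"
      by (intro sum_mono order.trans[OF degree_smult_le]) simp
    also have "\<dots> = N" using that fin card by simp
    finally show ?thesis .
  qed
  have "(\<Sum>j\<in>J. poly (L j) z * y j ^ t) = z ^ t" if t: "t \<le> N" for t
  proof -
    \<comment> \<open>The interpolation error of X^t: its degree is at most N and it has N + 1
      distinct roots.\<close>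
    define g where "g = (\<Sum>j\<in>J. Polynomial.smult (y j ^ t) (L j)) - Polynomial.monom 1 t"
    have deg: "Polynomial.degree g \<le> N"
      unfolding g_def using degL t
      by (intro degree_diff_le degree_sum_le order.trans[OF degree_smult_le] fin)
         (auto simp: degree_monom_eq)
    have root: "poly g (y k) = 0" if "k \<in> J" for k
    proof -
      have "(\<Sum>j\<in>J. y j ^ t * poly (L j) (y k)) = (\<Sum>j\<in>J. if j = k then y j ^ t else 0)"
        using that L by (intro sum.cong) auto
      then show ?thesis
        using that fin by (simp add: g_def poly_sum poly_monom)
    qed
    have "g = 0"
    proof (rule ccontr)
      assume "g \<noteq> 0"
      have "card (y ` J) \<le> card {x. poly g x = 0}"
        using root by (intro card_mono poly_roots_finite \<open>g \<noteq> 0\<close>) blast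
      also have "\<dots> \<le> Polynomial.degree g"
        by (rule card_poly_roots_bound[OF \<open>g \<noteq> 0\<close>])
      finally have "card (y ` J) \<le> Polynomial.degree g" .
      then show False using deg card card_image[OF inj] by simp
    qed
    then have "poly g z = 0" by simp
    then show ?thesis by (simp add: g_def poly_sum poly_monom mult.commute)
  qed
  then show ?thesis by (intro exI[of _ "\<lambda>j. poly (L j) z"]) auto
qed

lemma geometric_roots_dvd:
  fixes g :: "'f::field poly" and n :: nat
  assumes "inj_on l {..<n}" and "\<And>t. t < n \<Longrightarrow> poly g (l t) = 0"
  shows "(\<Prod>t<n. [:- l t, 1:]) dvd g"
  using assms
proof (induction n)
  case (Suc n)
  then obtain h where h: "g = (\<Prod>t<n. [:- l t, 1:]) * h"
    by (auto simp: lessThan_Suc inj_on_insert elim!: dvdE)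
  have "poly (\<Prod>t<n. [:- l t, 1:]) (l n) \<noteq> 0"
    using Suc.prems(1) by (fastforce simp: poly_prod dest: inj_onD)
  then have "poly h (l n) = 0"
    using Suc.prems(2)[of n] by (simp add: h)
  then have "(\<Prod>t<n. [:- l t, 1:]) * [:- l n, 1:] dvd (\<Prod>t<n. [:- l t, 1:]) * h"
    by (intro mult_dvd_mono dvd_refl) (simp add: poly_eq_0_iff_dvd)
  then show ?case unfolding h prod.lessThan_Suc .
qed simp

text \<open>Modulo the product, a polynomial is determined by its values at the roots. Since X^j
  takes the value a^j (r^j)^t at \<open>a * r ^ t\<close>, the exponents j supply interpolation
  nodes r^j, and the positions t of the roots become the exponents. The nodes are distinct because r
  is not a root of unity, so J may be any set of N + 1 exponents; the freedom in J is what matters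
  later.\<close>

lemma monom_reduction:
  fixes a r :: "'f::field"
  assumes "a \<noteq> 0" "r \<noteq> 0" and r: "\<And>k. k > 0 \<Longrightarrow> r ^ k \<noteq> 1"
    and J: "finite J" "card J = Suc N"
  shows "\<exists>c. (\<Prod>t<Suc N. [:- (a * r ^ t), 1:]) dvd Polynomial.monom 1 n - (\<Sum>j\<in>J. Polynomial.monom (c j) j)"
proof -
  have inj: "inj (\<lambda>j. r ^ j)"
  proof (rule linorder_injI)
    fix i j :: nat assume "i < j"
    then show "r ^ i \<noteq> r ^ j"
      using r[of "j - i"] assms(2) by (auto simp: power_diff)
  qed
  from lagrange_moments[OF J(1) inj_on_subset[OF inj subset_UNIV] J(2), of "r ^ n"]
  obtain c where c: "\<And>t. t \<le> N \<Longrightarrow> (\<Sum>j\<in>J. c j * (r ^ j) ^ t) = (r ^ n) ^ t" by blast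
  define d where "d j = c j * a ^ n / a ^ j" for j
  have "(\<Prod>t<Suc N. [:- (a * r ^ t), 1:]) dvd Polynomial.monom 1 n - (\<Sum>j\<in>J. Polynomial.monom (d j) j)"
  proof (rule geometric_roots_dvd)
    show "inj_on (\<lambda>t. a * r ^ t) {..<Suc N}"
      using inj assms(1) by (auto simp: inj_on_def)
  next
    fix t assume t: "t < Suc N"
    have "(\<Sum>j\<in>J. d j * (a * r ^ t) ^ j) = (\<Sum>j\<in>J. a ^ n * (c j * (r ^ j) ^ t))"
      using assms(1) by (intro sum.cong)
        (auto simp: d_def power_mult_distrib power_mult[symmetric] mult_ac)
    also have "\<dots> = (a * r ^ t) ^ n"
      using c[of t] t
      by (simp add: sum_distrib_left[symmetric] power_mult_distrib power_mult[symmetric] mult.commute)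
    finally show "poly (Polynomial.monom 1 n - (\<Sum>j\<in>J. Polynomial.monom (d j) j)) (a * r ^ t) = 0"
      by (simp add: poly_sum poly_monom)
  qed
  then show ?thesis by blast
qed

section \<open>Operators on a vector space\<close>

locale scalars = vector_space sc for sc :: "'f::field \<Rightarrow> 'v \<Rightarrow> 'v::ab_group_add"
begin

abbreviation lin :: "('v \<Rightarrow> 'v) \<Rightarrow> bool" where
  "lin f \<equiv> Vector_Spaces.linear sc sc f"

lemma lin_iff: "lin f \<longleftrightarrow> (\<forall>u v. f (u + v) = f u + f v) \<and> (\<forall>c v. f (sc c v) = sc c (f v))"
  by (auto simp: Vector_Spaces.linear_def module_hom_def module_hom_axioms_def
      vector_space_axioms module_axioms)

lemma linI: "(\<And>u v. f (u + v) = f u + f v) \<Longrightarrow> (\<And>c v. f (sc c v) = sc c (f v)) \<Longrightarrow> lin f"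
  by (simp add: lin_iff)

lemma
  assumes "lin f"
  shows lin_add: "f (u + v) = f u + f v"
    and lin_scale: "f (sc c v) = sc c (f v)"
    and lin_0: "f 0 = 0"
    and lin_diff: "f (u - v) = f u - f v"
    and lin_neg: "f (- v) = - f v"
    and lin_sum: "f (sum h I) = (\<Sum>i\<in>I. f (h i))"
proof -
  interpret Vector_Spaces.linear sc sc f by (rule assms)
  show "f (u + v) = f u + f v" "f (sc c v) = sc c (f v)" "f 0 = 0" "f (u - v) = f u - f v"
    "f (- v) = - f v" "f (sum h I) = (\<Sum>i\<in>I. f (h i))"
    by (simp_all add: add scale diff neg sum)
qed

lemmas lin_simps = lin_add lin_scale lin_0 lin_diff lin_neg

lemma lin_funpow: "lin f \<Longrightarrow> lin (f ^^ k)"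
  by (induction k) (auto simp: lin_iff)

lemma lin_eq_on_span:
  assumes "lin f" "lin g" "\<And>v. v \<in> S \<Longrightarrow> f v = g v" "u \<in> span S"
  shows "f u = g u"
  using assms(4) by (induction rule: span_induct_alt) (simp_all add: assms lin_simps)

lemma lin_image_span:
  assumes "lin f" "\<And>v. v \<in> S \<Longrightarrow> f v \<in> T" "subspace T" "u \<in> span S"
  shows "f u \<in> T"
  using assms(4)
  by (induction rule: span_induct_alt)
    (simp_all add: assms(1,2) lin_simps subspace_0 subspace_add subspace_scale assms(3))

text \<open>\<open>chain Y l x t\<close> is the image of \<open>x\<close> under the first \<open>t\<close> of the commuting maps
  \<open>z \<mapsto> Y z - l\<^sub>s z Y\<close>, and \<open>hsum Y x D g\<close> is the value at \<open>x\<close> of the homogenization of degree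
  \<open>D\<close> of the polynomial \<open>g\<close>, evaluated at left and right multiplication by \<open>Y\<close>.\<close>

primrec chain :: "('v \<Rightarrow> 'v) \<Rightarrow> (nat \<Rightarrow> 'f) \<Rightarrow> ('v \<Rightarrow> 'v) \<Rightarrow> nat \<Rightarrow> 'v \<Rightarrow> 'v" where
  "chain Y l x 0 = x"
| "chain Y l x (Suc t) = (\<lambda>v. Y (chain Y l x t v) - sc (l t) (chain Y l x t (Y v)))"

lemma lin_chain: "lin Y \<Longrightarrow> lin x \<Longrightarrow> lin (chain Y l x t)"
  by (induction t) (auto simp: lin_iff scale_right_diff_distrib scale_right_distrib algebra_simps)

definition hsum :: "('v \<Rightarrow> 'v) \<Rightarrow> ('v \<Rightarrow> 'v) \<Rightarrow> nat \<Rightarrow> 'f poly \<Rightarrow> 'v \<Rightarrow> 'v" where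
  "hsum Y x D g v = (\<Sum>i\<le>D. sc (poly.coeff g i) ((Y ^^ i) (x ((Y ^^ (D - i)) v))))"

lemma hsum_add: "hsum Y x D (g + h) v = hsum Y x D g v + hsum Y x D h v"
  by (simp add: hsum_def scale_left_distrib sum.distrib)

lemma hsum_diff: "hsum Y x D (g - h) v = hsum Y x D g v - hsum Y x D h v"
  by (simp add: hsum_def scale_left_diff_distrib sum_subtractf)

lemma hsum_smult: "hsum Y x D (Polynomial.smult c g) v = sc c (hsum Y x D g v)"
  by (simp add: hsum_def scale_sum_right)

lemma hsum_0: "hsum Y x D 0 v = 0"
  by (simp add: hsum_def)

lemma hsum_sum: "hsum Y x D (sum g I) v = (\<Sum>i\<in>I. hsum Y x D (g i) v)"
  by (induction I rule: infinite_finite_induct) (simp_all add: hsum_add hsum_0)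

lemma hsum_monom:
  "i \<le> D \<Longrightarrow> hsum Y x D (Polynomial.monom c i) v = sc c ((Y ^^ i) (x ((Y ^^ (D - i)) v)))"
  by (simp add: hsum_def if_distrib[of "\<lambda>c. sc c _"] cong: if_cong)

lemma hsum_shift:
  assumes "lin Y"
  shows "hsum Y x (Suc D) (pCons 0 g) v = Y (hsum Y x D g v)"
  unfolding hsum_def by (subst sum.atMost_Suc_shift) (simp add: lin_sum[OF assms] lin_scale[OF assms])

lemma hsum_degree:
  assumes "Polynomial.degree g \<le> D"
  shows "hsum Y x (Suc D) g v = hsum Y x D g (Y v)"
  using assms
  by (auto simp: hsum_def coeff_eq_0 Suc_diff_le funpow_Suc_right simp del: funpow.simps intro!: sum.cong)

lemma hsum_degree_le:
  assumes "Polynomial.degree g \<le> n"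
  shows "hsum Y x (n + k) g v = hsum Y x n g ((Y ^^ k) v)"
  using assms by (induction k arbitrary: v) (simp_all add: hsum_degree funpow_Suc_right del: funpow.simps)

lemma degree_linear_prod: "Polynomial.degree (\<Prod>t<n. [:- l t, 1::'f:]) = n"
  by (subst degree_prod_eq_sum_degree) auto

lemma chain_eq_hsum:
  assumes "lin Y"
  shows "chain Y l x n v = hsum Y x n (\<Prod>t<n. [:- l t, 1:]) v"
proof (induction n arbitrary: v)
  case (Suc n)
  define P where "P = (\<Prod>t<n. [:- l t, 1:])"
  have "(\<Prod>t<Suc n. [:- l t, 1:]) = pCons 0 P - Polynomial.smult (l n) P"
    by (simp add: P_def mult.commute)
  then show ?case
    using degree_linear_prod[of l n]
    by (simp add: Suc hsum_diff hsum_shift[OF assms] hsum_smult hsum_degree P_def[symmetric])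
qed (simp add: hsum_def)

lemma hsum_multiple_of_chain:
  assumes Y: "lin Y" and chain: "\<And>v. chain Y l x n v = 0"
    and "Polynomial.degree ((\<Prod>t<n. [:- l t, 1:]) * h) \<le> D"
  shows "hsum Y x D ((\<Prod>t<n. [:- l t, 1:]) * h) v = 0"
  using assms(3)
proof (induction h arbitrary: D v)
  case (pCons c h)
  define P where "P = (\<Prod>t<n. [:- l t, 1:])"
  have P: "Polynomial.degree P = n" "P \<noteq> 0"
    by (simp_all add: P_def degree_linear_prod)
  have deg: "n + Polynomial.degree (pCons c h) \<le> D"
  proof -
    have "pCons c h \<noteq> 0" using pCons.hyps by simp
    from degree_mult_eq[OF P(2) this] show ?thesis
      using pCons.prems P(1) unfolding P_def[symmetric] by linarith
  qed
  have 1: "hsum Y x D P v = 0"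
    using hsum_degree_le[of P n Y x "D - n" v] P(1) deg chain
    by (simp add: P_def chain_eq_hsum[OF Y, symmetric])
  have 2: "hsum Y x D (pCons 0 (P * h)) v = 0"
  proof (cases "h = 0")
    case False
    then have "Polynomial.degree (P * h) \<le> D - 1" "D > 0"
      using deg P by (simp_all add: degree_mult_eq)
    then show ?thesis
      using pCons.IH[of "D - 1" v] hsum_shift[OF Y, of x "D - 1" "P * h" v]
      by (simp add: P_def lin_0[OF Y])
  qed (simp add: hsum_0)
  show ?case
    using 1 2 by (simp add: P_def[symmetric] hsum_add hsum_smult)
qed (simp add: hsum_0)

text \<open>In total degree D the vectors Y^j x Y^(D-j) v inherit every congruence between monomials
  X^j modulo the polynomial with roots a r^t. The coefficients do not depend on v.\<close>

lemma chain_exchange: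
  assumes Y: "lin Y" and "a \<noteq> 0" "r \<noteq> 0" "\<And>k. k > 0 \<Longrightarrow> r ^ k \<noteq> 1"
    and chain: "\<And>v. chain Y (\<lambda>t. a * r ^ t) x (Suc N) v = 0"
    and J: "J \<subseteq> {..D}" "card J = Suc N" and n: "n \<le> D"
  shows "\<exists>c. \<forall>v. (Y ^^ n) (x ((Y ^^ (D - n)) v)) =
           (\<Sum>j\<in>J. sc (c j) ((Y ^^ j) (x ((Y ^^ (D - j)) v))))"
proof -
  have fin: "finite J" using J(1) finite_subset by blast
  have "\<exists>c. (\<Prod>t<Suc N. [:- (a * r ^ t), 1:]) dvd
      Polynomial.monom 1 n - (\<Sum>j\<in>J. Polynomial.monom (c j) j)"
    by (rule monom_reduction) (use assms fin in auto)
  then obtain c h where h: "Polynomial.monom 1 n - (\<Sum>j\<in>J. Polynomial.monom (c j) j)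
      = (\<Prod>t<Suc N. [:- (a * r ^ t), 1:]) * h"
    by (elim exE dvdE)
  have "Polynomial.degree (Polynomial.monom 1 n - (\<Sum>j\<in>J. Polynomial.monom (c j) j)) \<le> D"
    using n J(1) fin
    by (intro degree_diff_le degree_sum_le order.trans[OF degree_monom_le]) auto
  then have "hsum Y x D (Polynomial.monom 1 n - (\<Sum>j\<in>J. Polynomial.monom (c j) j)) v = 0" for v
    unfolding h by (intro hsum_multiple_of_chain[OF Y chain])
  then have "(Y ^^ n) (x ((Y ^^ (D - n)) v)) =
           (\<Sum>j\<in>J. sc (c j) ((Y ^^ j) (x ((Y ^^ (D - j)) v))))" for v
    using J(1) n by (simp add: hsum_diff hsum_sum hsum_monom subset_iff)
  then show ?thesis by blast
qed

end

section \<open>Strings of a graded raising operator\<close>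

lemma powi_inject:
  fixes p :: "'f::field"
  assumes p: "p \<noteq> 0" "\<And>k. k > 0 \<Longrightarrow> p ^ k \<noteq> 1" and eq: "p powi a = p powi b"
  shows "a = b"
proof -
  have *: False if "p powi a = p powi b" "a < b" for a b
  proof -
    have "p powi (b - a) = 1" using that p(1) by (simp add: power_int_diff)
    then have "p ^ nat (b - a) = 1" using that(2) by (simp add: power_int_def)
    then show False using p(2)[of "nat (b - a)"] that(2) by simp
  qed
  show ?thesis using *[of a b] *[of b a] eq by (cases a b rule: linorder_cases) auto
qed

text \<open>What a single index i contributes: the Borel part of one U_q(sl_2), with p in the role
  of q_i and K in that of the rescaled k_i.\<close>

locale graded = scalars sc for sc :: "'f::field \<Rightarrow> 'v \<Rightarrow> 'v::ab_group_add" +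
  fixes p :: 'f and K Kinv E :: "'v \<Rightarrow> 'v"
  assumes p_nz: "p \<noteq> 0" and p_root: "k > 0 \<Longrightarrow> p ^ k \<noteq> 1"
    and linK: "lin K" and linKinv: "lin Kinv" and linE: "lin E"
    and K_Kinv: "K (Kinv v) = v" and Kinv_K: "Kinv (K v) = v"
    and K_E: "K (E v) = sc (p powi 2) (E (K v))"
begin

definition wt :: "int \<Rightarrow> 'v set" where
  "wt b = {v. K v = sc (p powi b) v}"

lemma wt_subspace: "subspace (wt b)"
  by (auto simp: subspace_def wt_def lin_simps[OF linK] scale_right_distrib mult.commute)

lemmas wt_intros = subspace_0[OF wt_subspace] subspace_add[OF wt_subspace]
  subspace_diff[OF wt_subspace] subspace_scale[OF wt_subspace] subspace_sum[OF wt_subspace]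

lemma wt_K: "v \<in> wt b \<Longrightarrow> K v = sc (p powi b) v"
  by (simp add: wt_def)

lemma wt_Kinv:
  assumes "v \<in> wt b"
  shows "Kinv v = sc (p powi (- b)) v"
proof -
  have "sc (p powi b) (Kinv v) = v"
    using assms by (metis wt_K Kinv_K lin_scale[OF linKinv])
  then have "sc (p powi (- b)) (sc (p powi b) (Kinv v)) = sc (p powi (- b)) v" by simp
  then show ?thesis using p_nz by (simp add: power_int_minus)
qed

lemma wt_shift:
  assumes "lin x" "\<And>v. K (x v) = sc (p powi w) (x (K v))" "v \<in> wt b"
  shows "x v \<in> wt (b + w)"
  using assms(2,3) p_nz by (simp add: wt_def lin_simps[OF assms(1)] power_int_add mult.commute)

lemma wt_E_funpow: "v \<in> wt b \<Longrightarrow> (E ^^ k) v \<in> wt (b + 2 * int k)"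
  by (induction k) (auto dest: wt_shift[OF linE K_E] simp: algebra_simps)

lemma wt_sum_zero:
  assumes "finite I" "inj_on w I" "\<And>i. i \<in> I \<Longrightarrow> u i \<in> wt (w i)" "(\<Sum>i\<in>I. u i) = 0" "i \<in> I"
  shows "u i = 0"
  using assms
proof (induction I arbitrary: u i rule: finite_induct)
  case (insert c I)
  \<comment> \<open>The operator K minus the scalar \<open>p powi w c\<close>, applied to each term:
    it kills the term of index c and multiplies the others by nonzero scalars.\<close>
  define u' where "u' i = sc (p powi w i - p powi w c) (u i)" for i
  have "(\<Sum>i\<in>I. u' i) = (\<Sum>i\<in>insert c I. u' i)"
    using insert.hyps by (simp add: u'_def)
  also have "\<dots> = K (\<Sum>i\<in>insert c I. u i) - sc (p powi w c) (\<Sum>i\<in>insert c I. u i)"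
    unfolding lin_sum[OF linK] scale_sum_right sum_subtractf[symmetric]
    using insert.prems(2) by (intro sum.cong refl) (auto simp: u'_def wt_K[OF insert.prems(2)] scale_left_diff_distrib)
  also have "\<dots> = 0" using insert.prems(3) by (simp add: lin_0[OF linK])
  finally have sum0: "(\<Sum>i\<in>I. u' i) = 0" .
  have 0: "u' i = 0" if "i \<in> I" for i
  proof (rule insert.IH[OF _ _ sum0 that])
    show "inj_on w I" using insert.prems(1) by simp
    show "u' i \<in> wt (w i)" if "i \<in> I" for i
      unfolding u'_def using insert.prems(2)[of i] that by (intro wt_intros(4)) simp
  qed
  have I: "u i = 0" if "i \<in> I" for i
  proof -
    have "w i \<noteq> w c" using that insert.hyps(2) insert.prems(1) by (auto simp: inj_on_def)
    then have "p powi w i - p powi w c \<noteq> 0"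
      using powi_inject[OF p_nz p_root, of "w i" "w c"] by (metis eq_iff_diff_eq_0)
    then show ?thesis using 0[OF that] by (simp add: u'_def)
  qed
  then have "(\<Sum>i\<in>I. u i) = 0" by (intro sum.neutral) blast
  then have "u c = 0" using insert.prems(3) insert.hyps by simp
  then show ?case using I insert.prems(4) by blast
qed simp

text \<open>Every \<open>v \<in> wt b\<close> with \<open>E\<^bsup>l+1\<^esup> v = 0\<close> spans an \<open>E\<close>-string of weights \<open>b, b+2, \<dots>, b+2l\<close>;
  \<open>Fil c\<close> is spanned by the strings whose centre \<open>b + l\<close> is at most \<open>c\<close>.\<close>

definition Fil :: "int \<Rightarrow> 'v set" where
  "Fil c = span {(E ^^ k) v | k v b l. v \<in> wt b \<and> (E ^^ Suc l) v = 0 \<and> b + int l \<le> c}"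

lemma Fil_subspace: "subspace (Fil c)"
  by (simp add: Fil_def)

lemmas Fil_intros = subspace_0[OF Fil_subspace] subspace_add[OF Fil_subspace]
  subspace_diff[OF Fil_subspace] subspace_scale[OF Fil_subspace] subspace_sum[OF Fil_subspace]

lemma Fil_gen:
  "v \<in> wt b \<Longrightarrow> (E ^^ Suc l) v = 0 \<Longrightarrow> b + int l \<le> c \<Longrightarrow> (E ^^ k) v \<in> Fil c"
  unfolding Fil_def by (intro span_base) blast

lemma Fil_E:
  assumes "u \<in> Fil c"
  shows "E u \<in> Fil c"
proof -
  have "E z \<in> Fil c" if "z \<in> {(E ^^ k) v | k v b l. v \<in> wt b \<and> (E ^^ Suc l) v = 0 \<and> b + int l \<le> c}" for z
  proof -
    from that obtain k v b l where "z = (E ^^ k) v" "v \<in> wt b" "(E ^^ Suc l) v = 0" "b + int l \<le> c"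
      by blast
    then show ?thesis using Fil_gen[of v b l c "Suc k"] by simp
  qed
  then show ?thesis
    using assms unfolding Fil_def by (rule lin_image_span[OF linE _ subspace_span])
qed

lemma E_funpow_zero:
  assumes "(E ^^ n) v = 0" "n \<le> k"
  shows "(E ^^ k) v = 0"
proof -
  have "(E ^^ (k - n + n)) v = 0"
    using assms(1) by (simp only: funpow_add o_apply lin_0[OF lin_funpow[OF linE]])
  then show ?thesis using assms(2) by simp
qed

text \<open>This is complete reducibility of the tensor product of two strings, extracted from the quotient
  of such a product spanned by the vectors \<open>E\<^sup>i x E\<^sup>k v\<close>.\<close>

lemma chain_lowers_Fil:
  assumes x: "lin x" "\<And>b v. v \<in> wt b \<Longrightarrow> x v \<in> wt (b + w)"
    and a: "a \<noteq> 0" and chain: "\<And>v. chain E (\<lambda>t. a * (p ^ 2) ^ t) x (Suc N) v = 0"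
    and u: "u \<in> Fil c"
  shows "x u \<in> Fil (c + w + int N)"
proof -
  define C where "C = c + w + int N"
  have ex: "\<exists>c. \<forall>v. (E ^^ n) (x ((E ^^ (D - n)) v)) =
      (\<Sum>j\<in>J. sc (c j) ((E ^^ j) (x ((E ^^ (D - j)) v))))"
    if "J \<subseteq> {..D}" "card J = Suc N" "n \<le> D" for J D n
  proof (rule chain_exchange[OF linE a _ _ chain that])
    show "(p ^ 2) ^ k \<noteq> 1" if "k > 0" for k
      using p_root[of "2 * k"] that by (simp add: power_mult)
  qed (simp add: p_nz)
  \<comment> \<open>The claim covers all E^i x E^k v of one total degree d. Those with i > 0 follow
    from degree d - 1 by \<open>Fil_E\<close>, which leaves only x E^d v.\<close>
  have gen: "\<forall>i k. i + k = d \<longrightarrow> (E ^^ i) (x ((E ^^ k) v)) \<in> Fil C"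
    if v: "v \<in> wt b" "(E ^^ Suc l) v = 0" "b + int l \<le> c" for v b l d
  proof (induction d rule: less_induct)
    case (less d)
    have pos: "(E ^^ i) (x ((E ^^ k) v)) \<in> Fil C" if "i + k = d" "i > 0" for i k
    proof -
      from that(2) obtain i' where i: "i = Suc i'" by (cases i) auto
      have "(E ^^ i') (x ((E ^^ k) v)) \<in> Fil C" using less[of "i' + k"] that i by simp
      then show ?thesis by (simp add: i Fil_E)
    qed
    have "x ((E ^^ d) v) \<in> Fil C"
    proof -
      consider "d > l" | "d > N" | "d \<le> l" "d \<le> N" by linarith
      then show ?thesis
      proof cases
        case 1
        then have "(E ^^ d) v = 0" using E_funpow_zero[OF v(2), of d] by simp
        then show ?thesis by (simp add: lin_0[OF x(1)] Fil_intros)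
      next
        case 2
        \<comment> \<open>For d > N there is room for the exponents 1, ..., N + 1, so x E^d v is a
          combination of terms covered by \<open>pos\<close>.\<close>
        from ex[of "{1..Suc N}" d 0] 2 obtain c where
          "\<And>v. x ((E ^^ d) v) = (\<Sum>j = 1..Suc N. sc (c j) ((E ^^ j) (x ((E ^^ (d - j)) v))))"
          by (auto simp del: sum.cl_ivl_Suc)
        then show ?thesis
          using 2 by (simp del: sum.cl_ivl_Suc) (intro Fil_intros pos; simp)
      next
        case 3
        \<comment> \<open>After correction by \<open>y\<close>, the vector x E^d v should start the
          d-th Clebsch-Gordan summand. That string has N + l - 2 d + 1 = e vectors and starts at
          weight b + 2 d + w, so its centre is b + l + w + N for every d.\<close>
        define e where "e = Suc (N - d + (l - d))"
        define D where "D = e + d"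
        \<comment> \<open>This set has (N - d + 1) + d elements. For the low exponents D - j is at
          least l + 1, so these terms vanish; the high ones have E^e as a left factor, and
          cancelling it leaves terms of degree d with a positive power of E in front.\<close>
        define J where "J = {..N - d} \<union> {Suc e..D}"
        have "card J = Suc N"
          unfolding J_def using 3 by (subst card_Un_disjoint) (auto simp: e_def D_def)
        moreover have "J \<subseteq> {..D}" "e \<le> D"
          using 3 by (auto simp: J_def D_def e_def)
        ultimately obtain c where c: "\<And>v. (E ^^ e) (x ((E ^^ (D - e)) v)) =
            (\<Sum>j\<in>J. sc (c j) ((E ^^ j) (x ((E ^^ (D - j)) v))))"
          using ex[of J D e] by blast
        define y where "y = (\<Sum>j\<in>{Suc e..D}. sc (c j) ((E ^^ (j - e)) (x ((E ^^ (D - j)) v))))"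
        have "(E ^^ e) (x ((E ^^ d) v)) = (\<Sum>j\<in>J. sc (c j) ((E ^^ j) (x ((E ^^ (D - j)) v))))"
          using c[of v] by (simp add: D_def)
        also have "\<dots> = (\<Sum>j\<in>{Suc e..D}. sc (c j) ((E ^^ j) (x ((E ^^ (D - j)) v))))"
        proof (rule sum.mono_neutral_right)
          show "\<forall>j\<in>J - {Suc e..D}. sc (c j) ((E ^^ j) (x ((E ^^ (D - j)) v))) = 0"
          proof
            fix j assume "j \<in> J - {Suc e..D}"
            then have "Suc l \<le> D - j" using 3 by (auto simp: J_def D_def e_def)
            then have "(E ^^ (D - j)) v = 0" using E_funpow_zero[OF v(2)] by blast
            then show "sc (c j) ((E ^^ j) (x ((E ^^ (D - j)) v))) = 0"
              by (simp add: lin_0[OF x(1)] lin_0[OF lin_funpow[OF linE]])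
          qed
        qed (auto simp: J_def)
        also have "\<dots> = (E ^^ e) y"
          unfolding y_def lin_sum[OF lin_funpow[OF linE]]
        proof (rule sum.cong)
          fix j assume "j \<in> {Suc e..D}"
          then have "E ^^ j = E ^^ (e + (j - e))" by simp
          then have "(E ^^ j) z = (E ^^ e) ((E ^^ (j - e)) z)" for z
            by (simp only: funpow_add o_apply)
          then show "sc (c j) ((E ^^ j) (x ((E ^^ (D - j)) v))) =
              (E ^^ e) (sc (c j) ((E ^^ (j - e)) (x ((E ^^ (D - j)) v))))"
            by (simp add: lin_scale[OF lin_funpow[OF linE]])
        qed simp
        finally have zero: "(E ^^ e) (x ((E ^^ d) v) - y) = 0"
          by (simp add: lin_diff[OF lin_funpow[OF linE]])
        have "(E ^^ (j - e)) (x ((E ^^ (D - j)) v)) \<in> wt (b + 2 * int d + w)" if "j \<in> {Suc e..D}" for j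
        proof -
          have "(E ^^ (j - e)) (x ((E ^^ (D - j)) v)) \<in> wt (b + 2 * int (D - j) + w + 2 * int (j - e))"
            by (intro wt_E_funpow x v(1))
          moreover have "b + 2 * int (D - j) + w + 2 * int (j - e) = b + 2 * int d + w"
            using that by (auto simp: D_def)
          ultimately show ?thesis by simp
        qed
        then have "y \<in> wt (b + 2 * int d + w)"
          unfolding y_def by (intro wt_intros)
        then have "x ((E ^^ d) v) - y \<in> wt (b + 2 * int d + w)"
          by (intro wt_intros x wt_E_funpow v(1))
        from Fil_gen[OF this, of "N - d + (l - d)" C 0]
        have "x ((E ^^ d) v) - y \<in> Fil C"
          using zero 3 v(3) by (simp add: e_def C_def of_nat_diff)
        moreover have "y \<in> Fil C"
          unfolding y_def by (intro Fil_intros pos) (auto simp: D_def)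
        ultimately have "(x ((E ^^ d) v) - y) + y \<in> Fil C" by (rule Fil_intros(2))
        then show ?thesis by simp
      qed
    qed
    then show ?case using pos
    proof (intro allI impI)
      fix i k assume ik: "i + k = d"
      show "(E ^^ i) (x ((E ^^ k) v)) \<in> Fil C"
      proof (cases "i = 0")
        case True
        then show ?thesis using ik \<open>x ((E ^^ d) v) \<in> Fil C\<close> by simp
      next
        case False
        then show ?thesis using ik by (intro pos) auto
      qed
    qed
  qed
  have "x z \<in> Fil C" if "z \<in> {(E ^^ k) v | k v b l. v \<in> wt b \<and> (E ^^ Suc l) v = 0 \<and> b + int l \<le> c}" for z
  proof -
    from that obtain k v b l where z: "z = (E ^^ k) v"
      and "v \<in> wt b" "(E ^^ Suc l) v = 0" "b + int l \<le> c"
      by (elim CollectE exE conjE)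
    from gen[OF this(2-4), of k, THEN spec[of _ 0], THEN spec[of _ k]] show ?thesis by (simp add: z)
  qed
  then show ?thesis
    using u unfolding C_def[symmetric] Fil_def[of c]
    by (rule lin_image_span[OF x(1) _ Fil_subspace])
qed

text \<open>An operator that commutes with E up to a scalar is a string of length one, the case N =
  0.\<close>

lemma commuting_lowers_Fil:
  assumes "lin x" "\<And>b v. v \<in> wt b \<Longrightarrow> x v \<in> wt (b + w)"
    and "a \<noteq> 0" "\<And>v. E (x v) = sc a (x (E v))" "u \<in> Fil c"
  shows "x u \<in> Fil (c + w)"
  using chain_lowers_Fil[OF assms(1,2,3), of 0 u c] assms(4,5) by simp

end

section \<open>Commutators with iterated twisted commutators\<close>

context scalars
begin

lemma lin_comp: "lin f \<Longrightarrow> lin g \<Longrightarrow> lin (\<lambda>v. f (g v))"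
  by (simp add: lin_iff)

lemma lin_plus: "lin f \<Longrightarrow> lin g \<Longrightarrow> lin (\<lambda>v. f v + g v)"
  by (simp add: lin_iff scale_right_distrib algebra_simps)

lemma lin_minus: "lin f \<Longrightarrow> lin g \<Longrightarrow> lin (\<lambda>v. f v - g v)"
  by (simp add: lin_iff scale_right_diff_distrib algebra_simps)

lemma lin_smult: "lin f \<Longrightarrow> lin (\<lambda>v. sc c (f v))"
  by (simp add: lin_iff scale_right_distrib mult.commute)

text \<open>The analogue, for the adjoint action of Y, of the formula that moves Z past Y^t applied
  to an extremal vector. The twist \<open>l t\<close> is the scalar by which K' passes the t-th
  chain, so all terms in K' cancel. For h = 1 / (p - 1/p) the scalar in front of the last term is
  [t][m - t + 1]. Both choices of the raising and lowering operator as Z and Y are needed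
  later.\<close>

lemma chain_commutator:
  assumes Z: "lin Z" and Y: "lin Y" and y: "lin y" and K: "lin K" "lin K'"
    and p: "p \<noteq> (0::'f)"
    and ZY: "\<And>v. Z (Y v) = Y (Z v) + sc h (K v - K' v)"
    and KY: "\<And>v. K (Y v) = sc (p powi (- 2)) (Y (K v))"
      "\<And>v. K' (Y v) = sc (p powi 2) (Y (K' v))"
    and Ky: "\<And>v. K (y v) = sc (p powi m) (y (K v))"
      "\<And>v. K' (y v) = sc (p powi (- m)) (y (K' v))"
    and d: "\<And>v. d v = Z (y v) - y (Z v)"
    and l: "\<And>t. l t = p powi (2 * int t - m)"
  shows "Z (chain Y l y t v) = chain Y l y t (Z v) + chain Y l d t v
    + sc (h * (\<Sum>u<t. p powi (m - 2 * int u) - p powi (2 * int u - m))) (chain Y l y (t - 1) (K v))"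
proof (induction t arbitrary: v)
  case 0
  then show ?case by (simp add: d)
next
  case (Suc t)
  define c where "c = chain Y l y t"
  define g where "g t = h * (\<Sum>u<t. p powi (m - 2 * int u) - p powi (2 * int u - m))" for t
  have c: "lin c" unfolding c_def by (intro lin_chain Y y)
  have Kc: "K (c v) = sc (p powi (m - 2 * int t)) (c (K v))
      \<and> K' (c v) = sc (p powi (2 * int t - m)) (c (K' v))" for v
    unfolding c_def
  proof (induction t arbitrary: v)
    case (Suc t)
    have "p powi (m - 2 * int (Suc t)) = p powi (- 2) * p powi (m - 2 * int t)"
      "p powi (2 * int (Suc t) - m) = p powi 2 * p powi (2 * int t - m)"
      using p by (simp_all only: power_int_add[symmetric] simp_thms) (simp_all add: algebra_simps)
    then show ?case
      by (simp only: chain.simps Suc KY lin_simps[OF K(1)] lin_simps[OF K(2)] lin_simps[OF Y]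
        lin_simps[OF lin_chain[OF Y y]] scale_right_diff_distrib scale_scale mult_ac)
  qed (simp add: Ky)
  define c' where "c' = chain Y l y (t - 1)"
  have c': "lin c'" unfolding c'_def by (intro lin_chain Y y)
  \<comment> \<open>For t = 0 the truncated \<open>t - 1\<close> is harmless because
    \<open>g 0\<close> is an empty sum. For t > 0 the bracket is one step of the chain, as l t
    p^(-2) is the preceding twist.\<close>
  have prev: "sc (g t) (Y (c' (K v)) - sc (l t * p powi (- 2)) (c' (Y (K v)))) = sc (g t) (c (K v))" for v
  proof (cases t)
    case (Suc n)
    have "l t * p powi (- 2) = l n"
      using p by (simp add: l Suc power_int_add[symmetric] algebra_simps)
    then show ?thesis by (simp add: c_def c'_def Suc)
  qed (simp add: g_def)
  have lam: "l t = p powi (2 * int t - m)" by (rule l)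
  have g: "g (Suc t) = g t + h * (p powi (m - 2 * int t) - p powi (2 * int t - m))"
    by (simp add: g_def algebra_simps)
  have IH: "Z (c v) = c (Z v) + chain Y l d t v + sc (g t) (c' (K v))" for v
    using Suc by (simp add: c_def c'_def g_def)
  have inv: "p powi (2 * int t - m) * p powi (m - 2 * int t) = 1"
    using p by (simp add: power_int_add[symmetric])
  have "Z (chain Y l y (Suc t) v) = Z (Y (c v)) - sc (l t) (Z (c (Y v)))"
    by (simp add: c_def lin_simps[OF Z])
  also have "\<dots> = chain Y l y (Suc t) (Z v) + chain Y l d (Suc t) v
      + sc (h * (p powi (m - 2 * int t) - p powi (2 * int t - m))) (c (K v))
      + sc (g t) (Y (c' (K v)) - sc (l t * p powi (- 2)) (c' (Y (K v))))"
    using inv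
    by (simp add: c_def[symmetric] ZY IH lam Kc KY lin_simps[OF c] lin_simps[OF c'] lin_simps[OF Y] scale_right_diff_distrib
        scale_right_distrib scale_left_diff_distrib algebra_simps)
  also have "\<dots> = chain Y l y (Suc t) (Z v) + chain Y l d (Suc t) v + sc (g (Suc t)) (c (K v))"
    unfolding prev g by (simp add: scale_left_distrib)
  finally show ?case by (simp add: c_def g_def)
qed

text \<open>At t = m + 1 the sum of \<open>chain_commutator\<close> is antisymmetric under the
  reflection of u to m - u, hence 0. This is why the Serre exponent is 1 - A_ij: there the
  correction term disappears.\<close>

lemma chain_commutator_top:
  assumes Z: "lin Z" and Y: "lin Y" and y: "lin y" and K: "lin K" "lin K'"
    and p: "p \<noteq> (0::'f)"
    and ZY: "\<And>v. Z (Y v) = Y (Z v) + sc h (K v - K' v)"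
    and KY: "\<And>v. K (Y v) = sc (p powi (- 2)) (Y (K v))"
      "\<And>v. K' (Y v) = sc (p powi 2) (Y (K' v))"
    and Ky: "\<And>v. K (y v) = sc (p powi int m) (y (K v))"
      "\<And>v. K' (y v) = sc (p powi (- int m)) (y (K' v))"
    and d: "\<And>v. d v = Z (y v) - y (Z v)"
    and l: "\<And>t. l t = p powi (2 * int t - int m)"
  shows "Z (chain Y l y (Suc m) v) = chain Y l y (Suc m) (Z v) + chain Y l d (Suc m) v"
proof -
  define g where "g u = p powi (int m - 2 * int u)" for u
  have "g (Suc m - Suc u) = p powi (2 * int u - int m)" if "u < Suc m" for u
  proof -
    have "int m - 2 * int (Suc m - Suc u) = 2 * int u - int m" using that by (simp add: of_nat_diff)
    then show ?thesis unfolding g_def by (rule arg_cong)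
  qed
  then have "(\<Sum>u<Suc m. p powi (2 * int u - int m)) = (\<Sum>u<Suc m. g (Suc m - Suc u))"
    by (intro sum.cong) auto
  also have "\<dots> = (\<Sum>u<Suc m. g u)"
    by (rule sum.nat_diff_reindex)
  finally have "(\<Sum>u<Suc m. p powi (int m - 2 * int u) - p powi (2 * int u - int m)) = 0"
    unfolding sum_subtractf g_def by simp
  then show ?thesis
    using chain_commutator[where Z = Z and Y = Y and y = y and K = K and K' = K' and p = p and h = h
        and m = "int m" and d = d and l = l, OF assms, of "Suc m" v] by (simp only: mult_zero_right scale_zero_left add_0_right)
qed

end

section \<open>The lowering operator\<close>

text \<open>\<open>Fil_0\<close> and \<open>Fil_neg\<close> together express that every string is
  centred at 0. The bound on the weights bounds the lengths of the strings, so that decompositions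
  into strings run over a finite index set.\<close>

locale balanced = graded sc p K Kinv E
  for sc :: "'f::field \<Rightarrow> 'v \<Rightarrow> 'v::ab_group_add" and p K Kinv E +
  assumes Fil_0: "Fil 0 = UNIV" and Fil_neg: "Fil (- 1) = {0}"
    and bounded: "\<exists>M. \<forall>b. M < \<bar>b\<bar> \<longrightarrow> wt b = {0}"
begin

lemma Fil_mono: "c \<le> c' \<Longrightarrow> Fil c \<subseteq> Fil c'"
  unfolding Fil_def
  by (rule span_mono, safe, intro exI conjI, rule refl, assumption, assumption, linarith)

text \<open>x maps V = \<open>Fil 0\<close> into \<open>Fil (w + N)\<close>, which is zero for a
  negative index.\<close>

lemma chain_zero:
  assumes "lin x" "\<And>b v. v \<in> wt b \<Longrightarrow> x v \<in> wt (b + w)"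
    and "a \<noteq> 0" "\<And>v. chain E (\<lambda>t. a * (p ^ 2) ^ t) x (Suc N) v = 0"
    and "w + int N < 0"
  shows "x v = 0"
  using chain_lowers_Fil[OF assms(1-4), of v 0] Fil_mono[of "w + int N" "- 1"] assms(5)
  by (auto simp: Fil_0 Fil_neg)

lemma commuting_zero:
  assumes "lin x" "\<And>b v. v \<in> wt b \<Longrightarrow> x v \<in> wt (b + w)"
    and "a \<noteq> 0" "\<And>v. E (x v) = sc a (x (E v))" "w < 0"
  shows "x v = 0"
  using chain_zero[OF assms(1,2,3), of 0 v] assms(4,5) by simp

text \<open>These are to become the lowest weight vectors of the irreducible summands of dimension l
  + 1, described without the lowering operator that has yet to be built. Centre 0 dictates the
  weight -l.\<close>

definition Prim :: "nat \<Rightarrow> 'v set" where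
  "Prim l = wt (- int l) \<inter> {v. (E ^^ Suc l) v = 0}"

lemma Prim_subspace: "subspace (Prim l)"
  unfolding subspace_def Prim_def
  using wt_subspace[of "- int l"]
  by (auto simp: subspace_def lin_simps[OF lin_funpow[OF linE]] lin_simps[OF linE])

text \<open>If E^k killed v for some k between 1 and l, then v would start a string of centre at
  most -l + k - 1 < 0 and lie in \<open>Fil (- 1)\<close>.\<close>

lemma E_funpow_Prim_inj:
  assumes "v \<in> Prim l" "k \<le> l" "(E ^^ k) v = 0"
  shows "v = 0"
proof (cases k)
  case (Suc k')
  then show ?thesis
    using Fil_gen[of v "- int l" k' "- 1" 0] assms by (auto simp: Prim_def Fil_neg)
qed (use assms in simp)

text \<open>Among the generators of \<open>Fil 0\<close>, those of negative centre vanish, those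
  with k > l vanish, and the remaining ones come from \<open>Prim l\<close>.\<close>

lemma span_Prim: "span {(E ^^ k) v | k v l. v \<in> Prim l \<and> k \<le> l} = UNIV" (is "span ?G = _")
proof -
  have "(E ^^ k) v \<in> span ?G" if v: "v \<in> wt b" "(E ^^ Suc l) v = 0" "b + int l \<le> 0" for k v b l
  proof (cases "b + int l = 0 \<and> k \<le> l")
    case True
    then have "b = - int l" by simp
    then have "v \<in> Prim l" using v by (simp add: Prim_def)
    then show ?thesis using True by (intro span_base) blast
  next
    case False
    then consider "b + int l \<le> - 1" | "l < k" using v(3) by linarith
    then have "(E ^^ k) v = 0"
    proof cases
      case 1
      then show ?thesis using Fil_gen[OF v(1,2), of "- 1" k] by (simp add: Fil_neg)
    next
      case 2
      then show ?thesis using E_funpow_zero[OF v(2), of k] by simp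
    qed
    then show ?thesis by (simp add: span_zero)
  qed
  then have "{(E ^^ k) v | k v b l. v \<in> wt b \<and> (E ^^ Suc l) v = 0 \<and> b + int l \<le> 0} \<subseteq> span ?G"
    by (intro subsetI) (elim CollectE exE conjE, simp only:)
  then have "Fil 0 \<subseteq> span ?G"
    unfolding Fil_def by (rule span_minimal) simp
  then show ?thesis by (simp add: Fil_0 top_unique)
qed

text \<open>With \<open>d\<close> the largest \<open>l - k\<close> such that \<open>f (l, k) \<noteq> 0\<close>, applying \<open>E\<^sup>d\<close> leaves only the terms
  \<open>E\<^sup>l f (l, l - d)\<close>, whose weights \<open>l\<close> are distinct.\<close>

lemma Prim_sum_zero:
  assumes fin: "finite I" and le: "\<And>l k. (l, k) \<in> I \<Longrightarrow> k \<le> l"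
    and f: "\<And>l k. (l, k) \<in> I \<Longrightarrow> f (l, k) \<in> Prim l"
    and sum: "(\<Sum>(l, k)\<in>I. (E ^^ k) (f (l, k))) = 0" and "i \<in> I"
  shows "f i = 0"
proof (rule ccontr)
  assume "f i \<noteq> 0"
  define S where "S = {i \<in> I. f i \<noteq> 0}"
  have "i \<in> S" using \<open>i \<in> I\<close> \<open>f i \<noteq> 0\<close> by (simp add: S_def)
  then have "S \<noteq> {}" by blast
  have "finite S" using fin by (simp add: S_def)
  note S = \<open>finite S\<close> \<open>S \<noteq> {}\<close>
  define d where "d = Max ((\<lambda>(l, k). l - k) ` S)"
  have "d \<in> (\<lambda>(l, k). l - k) ` S"
    unfolding d_def using S by (intro Max_in) auto
  then obtain l0 k0 where 0: "(l0, k0) \<in> S" "d = l0 - k0" by auto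
  have max: "l - k \<le> d" if "(l, k) \<in> S" for l k
    unfolding d_def using S that by (intro Max_ge) force+
  define T where "T = {(l, k). (l, k) \<in> S \<and> l - k = d}"
  have TS: "T \<subseteq> S" by (auto simp: T_def)
  have T: "finite T" using S(1) TS finite_subset by blast
  have "0 = (E ^^ d) (\<Sum>(l, k)\<in>I. (E ^^ k) (f (l, k)))"
    by (simp add: sum lin_0[OF lin_funpow[OF linE]])
  also have "\<dots> = (\<Sum>(l, k)\<in>I. (E ^^ (d + k)) (f (l, k)))"
    unfolding lin_sum[OF lin_funpow[OF linE]] by (simp add: funpow_add split_def)
  also have "\<dots> = (\<Sum>(l, k)\<in>T. (E ^^ (d + k)) (f (l, k)))"
  proof (rule sum.mono_neutral_right[OF fin])
    show "T \<subseteq> I" using TS by (auto simp: S_def)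
    show "\<forall>i\<in>I - T. (case i of (l, k) \<Rightarrow> (E ^^ (d + k)) (f (l, k))) = 0"
    proof clarify
      fix l k assume *: "(l, k) \<in> I" "(l, k) \<notin> T"
      show "(E ^^ (d + k)) (f (l, k)) = 0"
      proof (cases "f (l, k) = 0")
        case False
        then have "(l, k) \<in> S" using * by (simp add: S_def)
        then have "l - k < d" using max[of l k] * by (auto simp: T_def)
        then have "Suc l \<le> d + k" by linarith
        then show ?thesis using f[OF *(1)] E_funpow_zero by (auto simp: Prim_def simp del: funpow.simps)
      qed (simp add: lin_0[OF lin_funpow[OF linE]])
    qed
  qed
  also have "\<dots> = (\<Sum>i\<in>T. (E ^^ fst i) (f i))"
  proof (rule sum.cong)
    fix i assume "i \<in> T"
    then have "d + snd i = fst i" using TS le[of "fst i" "snd i"] by (auto simp: T_def S_def)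
    then show "(case i of (l, k) \<Rightarrow> (E ^^ (d + k)) (f (l, k))) = (E ^^ fst i) (f i)"
      by (simp add: split_def)
  qed simp
  finally have sumT: "(\<Sum>i\<in>T. (E ^^ fst i) (f i)) = 0" by simp
  have "(E ^^ fst (l0, k0)) (f (l0, k0)) = 0"
  proof (rule wt_sum_zero[where I = T and w = "\<lambda>i. int (fst i)" and u = "\<lambda>i. (E ^^ fst i) (f i)"
        and i = "(l0, k0)", OF T _ _ sumT])
    show "inj_on (\<lambda>i. int (fst i)) T"
    proof (rule inj_onI)
      fix i j assume *: "i \<in> T" "j \<in> T" "int (fst i) = int (fst j)"
      have "snd i \<le> fst i" "snd j \<le> fst j"
        using *(1,2) TS le[of "fst i" "snd i"] le[of "fst j" "snd j"] by (auto simp: S_def)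
      moreover have "fst i - snd i = fst j - snd j" using *(1,2) by (auto simp: T_def)
      ultimately have "snd i = snd j" using *(3) by linarith
      then show "i = j" using *(3) by (simp add: prod_eq_iff)
    qed
    show "(E ^^ fst i) (f i) \<in> wt (int (fst i))" if "i \<in> T" for i
    proof -
      have "f i \<in> Prim (fst i)" using that TS f[of "fst i" "snd i"] by (auto simp: S_def)
      then have "(E ^^ fst i) (f i) \<in> wt (- int (fst i) + 2 * int (fst i))"
        by (intro wt_E_funpow) (simp add: Prim_def)
      then show ?thesis by simp
    qed
    show "(l0, k0) \<in> T" using 0 by (simp add: T_def)
  qed
  moreover have "f (l0, k0) \<in> Prim l0" using 0(1) f[of l0 k0] by (simp add: S_def)
  ultimately have "f (l0, k0) = 0"
    using E_funpow_Prim_inj[of "f (l0, k0)" l0 l0] by simp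
  then show False using 0(1) by (simp add: S_def)
qed

definition qn :: "int \<Rightarrow> 'f" where
  "qn b = (p powi b - p powi (- b)) / (p - inverse p)"

definition H :: "'v \<Rightarrow> 'v" where
  "H v = sc (1 / (p - inverse p)) (K v - Kinv v)"

lemma H_wt: "v \<in> wt b \<Longrightarrow> H v = sc (qn b) v"
  by (simp add: H_def qn_def wt_K wt_Kinv scale_left_diff_distrib diff_divide_distrib scale_right_diff_distrib)

lemma lin_H: "lin H"
  unfolding H_def by (intro lin_smult lin_minus linK linKinv)

lemma p_minus_inverse: "p - inverse p \<noteq> 0"
proof
  assume "p - inverse p = 0"
  then have "p * p = 1" using p_nz by (metis eq_iff_diff_eq_0 right_inverse)
  then show False using p_root[of 2] by (simp add: power2_eq_square)
qed

text \<open>This is E F - F E = H read off on E^k v, a vector of weight 2 k - l, when F sends E^k v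
  to [k][l - k + 1] E^(k-1) v.\<close>

lemma qn_identity: "qn k * qn (l - k + 1) - qn (k + 1) * qn (l - k) = qn (2 * k - l)"
proof -
  define e where "e a = p powi a" for a
  have e_add: "e a * e b = e (a + b)" for a b
    using p_nz by (simp add: e_def power_int_add)
  have qn: "qn b = (e b - e (- b)) / (e 1 - e (- 1))" for b
    by (simp add: qn_def e_def)
  have nz: "e 1 - e (- 1) \<noteq> 0" using p_minus_inverse by (simp add: e_def)
  have "(e k - e (- k)) * (e (l - k + 1) - e (- (l - k + 1)))
      - (e (k + 1) - e (- (k + 1))) * (e (l - k) - e (- (l - k)))
      = (e (2 * k - l) - e (- (2 * k - l))) * (e 1 - e (- 1))"
    by (simp add: left_diff_distrib right_diff_distrib e_add)
      (simp add: algebra_simps minus_diff_commute)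
  then show ?thesis
    using nz unfolding qn times_divide_times_eq diff_divide_distrib[symmetric]
    by (metis nonzero_mult_divide_mult_cancel_right)
qed

text \<open>Every vector is a sum \<open>S f\<close> of vectors E^k f(l, k) with f(l, k) in
  \<open>Prim l\<close>. By \<open>Prim_sum_zero\<close> the family is unique on I, so the
  prescribed images, collected in \<open>T f\<close>, define a linear operator without a choice of
  basis. At k = 0 the truncated k - 1 yields a multiple of v itself; a true lowering operator
  therefore needs \<open>coef l 0\<close> to vanish.\<close>

lemma exists_lowering:
  "\<exists>F. lin F \<and> (\<forall>l k v. v \<in> Prim l \<longrightarrow> k \<le> l \<longrightarrow>
        F ((E ^^ k) v) = sc (coef l k) ((E ^^ (k - 1)) v))"
proof -
  obtain M where M: "\<And>b. M < \<bar>b\<bar> \<Longrightarrow> wt b = {0}" using bounded by blast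
  define I where "I = {(l, k). k \<le> l \<and> l \<le> nat M}"
  have fin: "finite I"
    by (rule finite_subset[of _ "{..nat M} \<times> {..nat M}"]) (auto simp: I_def)
  define S where "S f = (\<Sum>i\<in>I. (E ^^ snd i) (f i))" for f
  define T where "T f = (\<Sum>i\<in>I. sc (coef (fst i) (snd i)) ((E ^^ (snd i - 1)) (f i)))" for f
  define fam where "fam f \<longleftrightarrow> (\<forall>i. f i \<in> Prim (fst i))" for f :: "nat \<times> nat \<Rightarrow> 'v"
  note linEk = lin_funpow[OF linE]
  have Prim0: "0 \<in> Prim l" for l by (rule subspace_0[OF Prim_subspace])
  have T_cong: "T f = T g" if "fam f" "fam g" "S f = S g" for f g
  proof -
    have "f i - g i = 0" if "i \<in> I" for i
    proof (rule Prim_sum_zero[OF fin, of "\<lambda>i. f i - g i", OF _ _ _ that])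
      show "k \<le> l" if "(l, k) \<in> I" for l k using that by (simp add: I_def)
      show "f (l, k) - g (l, k) \<in> Prim l" for l k
        using \<open>fam f\<close> \<open>fam g\<close> subspace_diff[OF Prim_subspace] by (metis fam_def fst_conv)
      have "S f - S g = 0" using \<open>S f = S g\<close> by simp
      then show "(\<Sum>(l, k)\<in>I. (E ^^ k) (f (l, k) - g (l, k))) = 0"
        by (simp add: S_def sum_subtractf lin_diff[OF linEk] split_def)
    qed
    then show ?thesis unfolding T_def by (intro sum.cong) auto
  qed
  define single where "single l k v = (\<lambda>i. if i = (l, k) then v else (0::'v))" for l k :: nat and v
  have single: "fam (single l k v)" "S (single l k v) = (E ^^ k) v"
    "T (single l k v) = sc (coef l k) ((E ^^ (k - 1)) v)"
    if "v \<in> Prim l" "k \<le> l" for l k v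
  proof -
    show "fam (single l k v)" using that Prim0 by (auto simp: fam_def single_def)
    \<comment> \<open>An index outside I has l beyond the bound on the weights, and there
      \<open>Prim l\<close> is zero.\<close>
    have cases: "(l, k) \<in> I \<or> v = 0"
    proof (cases "l \<le> nat M")
      case False
      then have "wt (- int l) = {0}" by (intro M) auto
      then show ?thesis using that(1) by (simp add: Prim_def)
    qed (use that(2) in \<open>simp add: I_def\<close>)
    have "S (single l k v) = (\<Sum>i\<in>I. if i = (l, k) then (E ^^ k) v else 0)"
      unfolding S_def single_def by (intro sum.cong) (auto simp: lin_0[OF linEk])
    then show "S (single l k v) = (E ^^ k) v"
      using cases fin by (auto simp: lin_0[OF linEk])
    have "T (single l k v) = (\<Sum>i\<in>I. if i = (l, k) then sc (coef l k) ((E ^^ (k - 1)) v) else 0)"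
      unfolding T_def single_def by (intro sum.cong) (auto simp: lin_0[OF linEk])
    then show "T (single l k v) = sc (coef l k) ((E ^^ (k - 1)) v)"
      using cases fin by (auto simp: lin_0[OF linEk])
  qed
  have add: "fam (\<lambda>i. f i + g i)" "S (\<lambda>i. f i + g i) = S f + S g" "T (\<lambda>i. f i + g i) = T f + T g"
    if "fam f" "fam g" for f g
    using that subspace_add[OF Prim_subspace]
    by (simp_all add: fam_def S_def T_def lin_add[OF linEk] sum.distrib scale_right_distrib)
  have scl: "fam (\<lambda>i. sc c (f i))" "S (\<lambda>i. sc c (f i)) = sc c (S f)" "T (\<lambda>i. sc c (f i)) = sc c (T f)"
    if "fam f" for f c
    using that subspace_scale[OF Prim_subspace]
    by (simp_all add: fam_def S_def T_def lin_scale[OF linEk] scale_sum_right mult.commute)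
  have surj: "\<exists>f. fam f \<and> S f = u" for u
  proof -
    have "u \<in> span {(E ^^ k) v | k v l. v \<in> Prim l \<and> k \<le> l}" unfolding span_Prim by simp
    then show ?thesis
    proof (induction rule: span_induct_alt)
      case base
      have "fam (\<lambda>i. 0)" "S (\<lambda>i. 0) = 0"
        by (simp_all add: fam_def Prim0 S_def lin_0[OF linEk])
      then show ?case by blast
    next
      case (step c x y)
      then obtain k v l f where *: "v \<in> Prim l" "k \<le> l" "x = (E ^^ k) v" "fam f" "S f = y" by blast
      define g where "g = (\<lambda>i. sc c (single l k v i))"
      have g: "fam g" "S g = sc c x"
        using scl(1,2)[OF single(1)[OF *(1,2)], of c] single(2)[OF *(1,2)] by (simp_all add: g_def *)
      show ?case
        using add(1,2)[OF g(1) *(4)] g(2) *(5) by (intro exI[of _ "\<lambda>i. g i + f i"]) simp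
    qed
  qed
  define F where "F u = T (SOME f. fam f \<and> S f = u)" for u
  have FS: "F (S f) = T f" if "fam f" for f
  proof -
    have "fam (SOME g. fam g \<and> S g = S f) \<and> S (SOME g. fam g \<and> S g = S f) = S f"
      by (rule someI[of _ f]) (simp add: that)
    then show ?thesis unfolding F_def using that by (intro T_cong) auto
  qed
  have "lin F"
  proof (rule linI)
    fix u v
    obtain f g where "fam f" "u = S f" "fam g" "v = S g" using surj by metis
    then show "F (u + v) = F u + F v"
      using FS[OF add(1), of f g] add(2,3)[of f g] by (simp add: FS)
  next
    fix c u
    obtain f where "fam f" "u = S f" using surj by metis
    then show "F (sc c u) = sc c (F u)"
      using FS[OF scl(1), of f c] scl(2,3)[of f c] by (simp add: FS)
  qed
  moreover have "F ((E ^^ k) v) = sc (coef l k) ((E ^^ (k - 1)) v)" if "v \<in> Prim l" "k \<le> l" for l k v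
    using FS[OF single(1)[OF that]] single(2,3)[OF that] by simp
  ultimately show ?thesis by blast
qed

text \<open>The coefficients [k][l - k + 1] are those of the irreducible U_q(sl_2)-module of
  dimension l + 1. The factor [0] at k = 0 makes F kill the lowest vector of each string.\<close>

lemma exists_F:
  "\<exists>F. lin F \<and> (\<forall>v. K (F v) = sc (p powi (- 2)) (F (K v))) \<and> (\<forall>v. E (F v) = F (E v) + H v)"
proof -
  obtain F where F: "lin F" and gen: "\<And>l k v. v \<in> Prim l \<Longrightarrow> k \<le> l \<Longrightarrow>
      F ((E ^^ k) v) = sc (qn (int k) * qn (int l - int k + 1)) ((E ^^ (k - 1)) v)"
    using exists_lowering[of "\<lambda>l k. qn (int k) * qn (int l - int k + 1)"] by blast
  have wt_gen: "(E ^^ k) v \<in> wt (2 * int k - int l)" if "v \<in> Prim l" for l k v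
    using wt_E_funpow[of v "- int l" k] that by (simp add: Prim_def)
  have KF: "K (F z) = sc (p powi (- 2)) (F (K z))"
    if "z \<in> {(E ^^ k) v | k v l. v \<in> Prim l \<and> k \<le> l}" for z
  proof -
    from that obtain k v l where z: "z = (E ^^ k) v" and v: "v \<in> Prim l" "k \<le> l" by blast
    show ?thesis
    proof (cases k)
      case 0
      then show ?thesis using gen[OF v] wt_K[OF wt_gen[OF v(1), of k]] z
        by (simp add: lin_simps[OF F] lin_simps[OF linK] qn_def)
    next
      case (Suc k')
      then show ?thesis
        using gen[OF v] wt_K[OF wt_gen[OF v(1), of k]] wt_K[OF wt_gen[OF v(1), of k']] z p_nz
        by (simp del: funpow.simps add: lin_simps[OF F] lin_simps[OF linK] power_int_add power_int_diff
            power_int_minus distrib_left divide_inverse mult_ac)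
    qed
  qed
  have EF: "E (F z) = F (E z) + H z"
    if "z \<in> {(E ^^ k) v | k v l. v \<in> Prim l \<and> k \<le> l}" for z
  proof -
    from that obtain k v l where z: "z = (E ^^ k) v" and v: "v \<in> Prim l" "k \<le> l" by blast
    have "E (F z) = sc (qn (int k) * qn (int l - int k + 1)) z"
      using gen[OF v] z by (cases k) (simp_all add: lin_simps[OF linE] qn_def)
    \<comment> \<open>At the top of a string, k = l, both sides vanish: E kills z and [l - k] =
      0.\<close>
    moreover have "F (E z) = sc (qn (int k + 1) * qn (int l - int k)) z"
    proof (cases "k < l")
      case True
      then show ?thesis using gen[OF v(1), of "Suc k"] z by (simp add: add.commute)
    next
      case False
      then have "E z = 0" "int l - int k = 0" using v z by (simp_all add: Prim_def)
      then show ?thesis by (simp add: lin_0[OF F] qn_def)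
    qed
    moreover have "H z = sc (qn (2 * int k - int l)) z"
      unfolding z by (rule H_wt[OF wt_gen[OF v(1)]])
    ultimately show ?thesis
      by (simp add: qn_identity[of "int k" "int l", symmetric] scale_left_distrib[symmetric])
  qed
  have UNIV: "v \<in> span {(E ^^ k) v | k v l. v \<in> Prim l \<and> k \<le> l}" for v
    unfolding span_Prim by simp
  show ?thesis
  proof (intro exI[of _ F] conjI allI)
    fix v
    show "K (F v) = sc (p powi (- 2)) (F (K v))"
    proof (rule lin_eq_on_span[where f = "\<lambda>v. K (F v)" and g = "\<lambda>v. sc (p powi (- 2)) (F (K v))",
          OF _ _ KF UNIV])
      show "lin (\<lambda>v. K (F v))" by (rule lin_comp[OF linK F])
      show "lin (\<lambda>v. sc (p powi (- 2)) (F (K v)))" by (rule lin_smult[OF lin_comp[OF F linK]])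
    qed
    show "E (F v) = F (E v) + H v"
    proof (rule lin_eq_on_span[where f = "\<lambda>v. E (F v)" and g = "\<lambda>v. F (E v) + H v",
          OF _ _ EF UNIV])
      show "lin (\<lambda>v. E (F v))" by (rule lin_comp[OF linE F])
      show "lin (\<lambda>v. F (E v) + H v)" by (rule lin_plus[OF lin_comp[OF F linE] lin_H])
    qed
  qed (rule F)
qed

text \<open>The difference of two candidates commutes with E and has weight -2, so it is a string of
  length one with centre -2.\<close>

lemma F_unique:
  assumes F: "lin F" "lin F'"
    and K: "\<And>v. K (F v) = sc (p powi (- 2)) (F (K v))" "\<And>v. K (F' v) = sc (p powi (- 2)) (F' (K v))"
    and E: "\<And>v. E (F v) - F (E v) = E (F' v) - F' (E v)"
  shows "F v = F' v"
proof -
  define D where "D = (\<lambda>v. F v - F' v)"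
  have D: "lin D" unfolding D_def by (rule lin_minus[OF F])
  have "K (D v) = sc (p powi (- 2)) (D (K v))" for v
    unfolding D_def lin_diff[OF linK] K scale_right_diff_distrib ..
  from wt_shift[OF D this] have "D v \<in> wt (b + - 2)" if "v \<in> wt b" for b v using that .
  moreover have "E (D v) = sc 1 (D (E v))" for v
    using E[of v] by (simp add: D_def lin_diff[OF linE] algebra_simps)
  ultimately have "D v = 0"
    by (intro commuting_zero[where x = D and w = "- 2" and a = 1, OF D]) simp_all
  then show ?thesis by (simp add: D_def)
qed

end

context scalars
begin

lemma chain_weight:
  assumes "lin K" "lin Y" "lin x"
    and KY: "\<And>v. K (Y v) = sc c (Y (K v))" and Kx: "\<And>v. K (x v) = sc d (x (K v))"
  shows "K (chain Y l x t v) = sc (c ^ t * d) (chain Y l x t (K v))"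
proof (induction t arbitrary: v)
  case (Suc t)
  show ?case
    by (simp only: chain.simps Suc KY lin_simps[OF assms(1)] lin_simps[OF assms(2)]
        lin_simps[OF lin_chain[OF assms(2,3)]] scale_right_diff_distrib scale_scale power_Suc mult_ac)
qed (simp add: Kx)

lemma chain_of_zero: "lin Y \<Longrightarrow> chain Y l (\<lambda>v. 0) t v = 0"
  by (induction t arbitrary: v) (simp_all add: lin_0)

end

section \<open>Weight decompositions and the common centre of the strings\<close>

context graded
begin

lemma span_wt_sum:
  assumes "u \<in> span (\<Union>b\<in>S. wt b)"
  shows "\<exists>I f. finite I \<and> I \<subseteq> S \<and> (\<forall>b. f b \<in> wt b) \<and> u = (\<Sum>b\<in>I. f b)"
  using assms
proof (induction rule: span_induct_alt)
  case base
  show ?case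
    by (intro exI[of _ "{}"] exI[of _ "\<lambda>b. 0"]) (simp add: wt_intros(1))
next
  case (step c x y)
  then obtain b I f where b: "b \<in> S" "x \<in> wt b"
    and I: "finite I" "I \<subseteq> S" and f: "\<And>b. f b \<in> wt b" and y: "y = (\<Sum>b\<in>I. f b)"
    by blast
  define g where "g a = (if a \<in> I then f a else 0) + (if a = b then sc c x else 0)" for a
  have "(\<Sum>a\<in>insert b I. if a \<in> I then f a else 0) = (\<Sum>a\<in>I. if a \<in> I then f a else 0)"
    using I(1) by (intro sum.mono_neutral_right) auto
  then have "(\<Sum>a\<in>insert b I. if a \<in> I then f a else 0) = y"
    by (simp add: y)
  moreover have "(\<Sum>a\<in>insert b I. if a = b then sc c x else 0) = sc c x"
    using I(1) by (subst sum.delta) auto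
  ultimately have "sc c x + y = (\<Sum>a\<in>insert b I. g a)"
    unfolding g_def sum.distrib by simp
  moreover have "g a \<in> wt a" for a
    using f b(2) by (simp add: g_def wt_intros(1,2,4))
  ultimately show ?case
    using I b(1) by (intro exI[of _ "insert b I"] exI[of _ g]) simp
qed

lemma span_wt_disjoint:
  assumes "u \<in> span (\<Union>b\<in>S. wt b)" "c \<notin> S" "u \<in> wt c"
  shows "u = 0"
proof -
  obtain I f where I: "finite I" "I \<subseteq> S" and f: "\<And>b. f b \<in> wt b" and u: "u = (\<Sum>b\<in>I. f b)"
    using span_wt_sum[OF assms(1)] by blast
  have c: "c \<notin> I" using I(2) assms(2) by blast
  define g where "g = f(c := - u)"
  have "(\<Sum>b\<in>I. g b) = u"
    unfolding u g_def using c by (intro sum.cong) auto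
  then have sum: "(\<Sum>b\<in>insert c I. g b) = 0"
    using I(1) c by (simp add: g_def)
  have "- u \<in> wt c" using wt_intros(3)[OF wt_intros(1) assms(3)] by simp
  then have "g b \<in> wt b" for b using f by (simp add: g_def)
  then have "g c = 0"
    using I(1) by (intro wt_sum_zero[where I = "insert c I" and w = "\<lambda>b. b" and u = g, OF _ _ _ sum]) simp_all
  then show ?thesis by (simp add: g_def)
qed

text \<open>Each vector of a finite spanning set involves finitely many weights, and
  \<open>span_wt_disjoint\<close> excludes all other weights.\<close>

lemma wt_bounded:
  assumes "finite B" "span B = UNIV" and wts: "span (\<Union>b. wt b) = UNIV"
  shows "\<exists>M. \<forall>b. M < \<bar>b\<bar> \<longrightarrow> wt b = {0}"
proof -
  have "\<exists>I. finite I \<and> x \<in> span (\<Union>b\<in>I. wt b)" for x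
  proof -
    have "x \<in> span (\<Union>b. wt b)" by (simp add: wts)
    from span_wt_sum[OF this] obtain I f
      where I: "finite I" and f: "\<forall>b. f b \<in> wt b" and x: "x = (\<Sum>b\<in>I. f b)" by blast
    have "x \<in> span (\<Union>b\<in>I. wt b)"
      unfolding x using f by (intro span_sum span_base) blast
    with I show ?thesis by blast
  qed
  then obtain I where I: "\<And>x. finite (I x)" "\<And>x. x \<in> span (\<Union>b\<in>I x. wt b)" by metis
  define J where "J = (\<Union>x\<in>B. I x)"
  have "finite J" using assms(1) I(1) by (simp add: J_def)
  have "x \<in> span (\<Union>b\<in>J. wt b)" if "x \<in> B" for x
    using span_mono[of "\<Union>b\<in>I x. wt b" "\<Union>b\<in>J. wt b"] I(2)[of x] that unfolding J_def by blast
  then have "span B \<subseteq> span (\<Union>b\<in>J. wt b)" by (intro span_minimal) auto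
  then have J: "u \<in> span (\<Union>b\<in>J. wt b)" for u using assms(2) by auto
  obtain M where M: "\<And>b. b \<in> J \<Longrightarrow> \<bar>b\<bar> \<le> M"
    using finite_imageI[OF \<open>finite J\<close>, of abs, THEN bdd_above_finite] by (auto simp: bdd_above_def)
  have "wt b = {0}" if "M < \<bar>b\<bar>" for b
  proof -
    have "b \<notin> J" using M that by force
    then have "\<And>u. u \<in> wt b \<Longrightarrow> u = 0" using span_wt_disjoint[OF J] by blast
    then show ?thesis using wt_intros(1) by blast
  qed
  then show ?thesis by blast
qed

text \<open>The two extreme weights \<open>\<plusminus>m\<close> force a common centre of all strings to be \<open>0\<close>.\<close>

lemma symmetric_imp_balanced:
  assumes wts: "span (\<Union>b. wt b) = UNIV" and nz: "(UNIV :: 'v set) \<noteq> {0}"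
    and bdd: "\<exists>M. \<forall>b. M < \<bar>b\<bar> \<longrightarrow> wt b = {0}"
    and sym: "\<And>b. wt b \<noteq> {0} \<Longrightarrow> wt (- b) \<noteq> {0}"
    and Fil: "\<And>c. Fil c = {0} \<or> Fil c = UNIV"
  shows "Fil 0 = UNIV" "Fil (- 1) = {0}"
proof -
  define B where "B = {b. wt b \<noteq> {0}}"
  obtain M where M: "\<And>b. M < \<bar>b\<bar> \<Longrightarrow> wt b = {0}" using bdd by blast
  have "B \<subseteq> {- M..M}"
  proof
    fix b assume "b \<in> B"
    then have "\<not> M < \<bar>b\<bar>" using M by (auto simp: B_def)
    then show "b \<in> {- M..M}" by auto
  qed
  then have fin: "finite B" by (rule finite_subset) simp
  have "B \<noteq> {}"
  proof
    assume "B = {}"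
    then have "(\<Union>b. wt b) = {0}" by (auto simp: B_def)
    then show False using wts nz by (simp add: span_empty span_insert_0)
  qed
  define m where "m = Max B"
  have "m \<in> B" unfolding m_def by (rule Max_in[OF fin \<open>B \<noteq> {}\<close>])
  have le: "b \<le> m" if "b \<in> B" for b unfolding m_def using that by (rule Max_ge[OF fin])
  have symB: "- b \<in> B" if "b \<in> B" for b using sym that by (simp add: B_def)
  have in_B: "b \<in> B" if "v \<in> wt b" "v \<noteq> 0" for v b using that by (auto simp: B_def)
  have ge: "- m \<le> b" if "b \<in> B" for b using le[OF symB[OF that]] by simp
  show "Fil 0 = UNIV"
  proof -
    have "wt (- m) \<noteq> {0}" using symB[OF \<open>m \<in> B\<close>] by (simp add: B_def)
    then obtain v where v: "v \<in> wt (- m)" "v \<noteq> 0" using wt_intros(1)[of "- m"] by blast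
    \<comment> \<open>This vector would have weight m + 2, above the largest weight. Hence v starts
      a string of centre at most 0.\<close>
    have "(E ^^ Suc (nat m)) v = 0"
    proof (rule ccontr)
      assume "(E ^^ Suc (nat m)) v \<noteq> 0"
      from le[OF in_B[OF wt_E_funpow[OF v(1)] this]] show False
        by (cases "m \<ge> 0") auto
    qed
    from Fil_gen[OF v(1) this, of 0 0] have "v \<in> Fil 0"
      using ge[OF \<open>m \<in> B\<close>] by simp
    then show ?thesis using Fil[of 0] v(2) by blast
  qed
  show "Fil (- 1) = {0}"
  proof (rule ccontr)
    assume "Fil (- 1) \<noteq> {0}"
    then have U: "Fil (- 1) = UNIV" using Fil by blast
    \<comment> \<open>With centres at most -1 the weight m is out of reach: from b >= -m, k \<le> l
      and b + l \<le> -1 follows b + 2 k \<le> -b - 2 \<le> m - 2.\<close>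
    have "(E ^^ k) v \<in> (\<Union>b\<in>- {m}. wt b)"
      if v: "v \<in> wt b" "(E ^^ Suc l) v = 0" "b + int l \<le> - 1" for k v b l
    proof (cases "(E ^^ k) v = 0")
      case True
      \<comment> \<open>The zero vector lies in every weight space; any weight other than m
        serves.\<close>
      then have "(E ^^ k) v \<in> wt (m + 1)" by (simp add: wt_intros(1))
      then show ?thesis by force
    next
      case False
      have "k \<le> l" using E_funpow_zero[OF v(2), of k] False by (cases "k \<le> l") auto
      moreover have "v \<noteq> 0" using False lin_0[OF lin_funpow[OF linE]] by auto
      then have "- m \<le> b" using in_B[OF v(1)] ge by blast
      ultimately have "b + 2 * int k \<noteq> m" using v(3) by linarith
      then show ?thesis using wt_E_funpow[OF v(1), of k] by blast
    qed
    then have "{(E ^^ k) v | k v b l. v \<in> wt b \<and> (E ^^ Suc l) v = 0 \<and> b + int l \<le> - 1}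
        \<subseteq> (\<Union>b\<in>- {m}. wt b)"
      by (intro subsetI) (elim CollectE exE conjE, simp only:)
    then have "Fil (- 1) \<subseteq> span (\<Union>b\<in>- {m}. wt b)"
      unfolding Fil_def by (rule span_mono)
    then have U': "u \<in> span (\<Union>b\<in>- {m}. wt b)" for u using U by auto
    have "u = 0" if "u \<in> wt m" for u
      using span_wt_disjoint[OF U' _ that] by simp
    then have "wt m = {0}" using wt_intros(1) by blast
    then show False using \<open>m \<in> B\<close> by (simp add: B_def)
  qed
qed

end

section \<open>Operators satisfying the relations of \<open>U\<^sup>\<ge>\<^sup>0\<close>\<close>

text \<open>The Borel module with \<alpha> scaled away, so that the type appears only as
  \<open>wts\<close> and \<open>sym\<close>. The Serre relation is put as an iterated q-commutator,
  the form in which E_j visibly generates a string under E_i.\<close>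

locale borel_operators = scalars sc for sc :: "'f::field \<Rightarrow> 'v \<Rightarrow> 'v::ab_group_add" +
  fixes p :: "'i \<Rightarrow> 'f" and a :: "'i \<Rightarrow> 'i \<Rightarrow> int" and K Kinv E :: "'i \<Rightarrow> 'v \<Rightarrow> 'v"
  assumes p_nz: "p i \<noteq> 0" and p_root: "k > 0 \<Longrightarrow> p i ^ k \<noteq> 1"
    and a_diag: "a i i = 2" and a_nonpos: "i \<noteq> j \<Longrightarrow> a i j \<le> 0"
    and linK: "lin (K i)" and linKinv: "lin (Kinv i)" and linE: "lin (E i)"
    and K_Kinv: "K i (Kinv i v) = v" and Kinv_K: "Kinv i (K i v) = v"
    and K_comm: "K i (K j v) = K j (K i v)"
    and K_E: "K i (E j v) = sc (p i powi a i j) (E j (K i v))"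
    and serre: "i \<noteq> j \<Longrightarrow>
      chain (E i) (\<lambda>t. p i powi (2 * int t + a i j)) (E j) (Suc (nat (- a i j))) v = 0"
    and irred: "subspace W \<Longrightarrow> (\<And>i. E i ` W \<subseteq> W \<and> K i ` W \<subseteq> W \<and> Kinv i ` W \<subseteq> W)
      \<Longrightarrow> W = {0} \<or> W = UNIV"
    and nz: "(UNIV :: 'v set) \<noteq> {0}"
    and finite_dim: "\<exists>B. finite B \<and> span B = UNIV"
    and wts: "span (\<Union>b. {v. K i v = sc (p i powi b) v}) = UNIV"
    and sym: "{v. K i v = sc (p i powi b) v} \<noteq> {0} \<Longrightarrow> {v. K i v = sc (p i powi (- b)) v} \<noteq> {0}"
begin

sublocale gr: graded sc "p i" "K i" "Kinv i" "E i" for i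
proof
  show "K i (E i v) = sc (p i powi 2) (E i (K i v))" for v using K_E[of i i v] by (simp only: a_diag)
qed (simp_all add: p_nz p_root lin_simps[OF linK] lin_simps[OF linKinv] lin_simps[OF linE] K_Kinv Kinv_K)

lemma Kinv_K_comm: "Kinv j (K i v) = K i (Kinv j v)"
  by (metis K_comm K_Kinv Kinv_K)

lemma Kinv_E: "Kinv i (E j v) = sc (p i powi (- a i j)) (E j (Kinv i v))"
proof -
  have "sc (p i powi (- a i j)) (E j (Kinv i v)) = Kinv i (K i (sc (p i powi (- a i j)) (E j (Kinv i v))))"
    by (simp add: Kinv_K)
  also have "\<dots> = Kinv i (E j v)"
    using p_nz[of i] by (simp add: lin_scale[OF linK] K_E K_Kinv power_int_minus)
  finally show ?thesis by simp
qed

lemma wt_K: "v \<in> gr.wt i b \<Longrightarrow> K j v \<in> gr.wt i b"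
  by (simp add: gr.wt_def K_comm[of i j] lin_scale[OF linK])

lemma wt_Kinv: "v \<in> gr.wt i b \<Longrightarrow> Kinv j v \<in> gr.wt i b"
  by (simp add: gr.wt_def Kinv_K_comm[symmetric] lin_scale[OF linKinv])

lemma wt_E: "v \<in> gr.wt i b \<Longrightarrow> E j v \<in> gr.wt i (b + a i j)"
  by (rule gr.wt_shift[OF linE K_E])

lemma E_K: "E i (K j v) = sc (p j powi (- a j i)) (K j (E i v))"
  using p_nz[of j] by (simp add: K_E power_int_minus)

lemma E_Kinv: "E i (Kinv j v) = sc (p j powi a j i) (Kinv j (E i v))"
  using p_nz[of j] by (simp add: Kinv_E power_int_minus)

lemma serre':
  assumes "i \<noteq> j"
  shows "chain (E i) (\<lambda>t. p i powi a i j * (p i ^ 2) ^ t) (E j) (Suc (nat (- a i j))) v = 0"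
proof -
  have "(\<lambda>t. p i powi a i j * (p i ^ 2) ^ t) = (\<lambda>t. p i powi (2 * int t + a i j))"
  proof
    fix t
    have "p i powi (2 * int t) = (p i ^ 2) ^ t"
      by (metis power_int_mult power_int_of_nat power_int_numeral)
    then show "p i powi a i j * (p i ^ 2) ^ t = p i powi (2 * int t + a i j)"
      using p_nz[of i] by (simp add: power_int_add)
  qed
  then show ?thesis by (simp only: serre[OF assms])
qed

text \<open>For E_j with j different from i, the starting weight \<open>a i j\<close> and the length
  parameter \<open>- a i j\<close> cancel, so the index c is preserved. The operators K_j and their
  inverses have weight 0 and commute with E_i up to scalars.\<close>

lemma Fil_trivial: "gr.Fil i c = {0} \<or> gr.Fil i c = UNIV"
proof (rule irred[OF gr.Fil_subspace])
  fix j
  have "E j u \<in> gr.Fil i c" if u: "u \<in> gr.Fil i c" for u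
  proof (cases "i = j")
    case False
    have "E j u \<in> gr.Fil i (c + a i j + int (nat (- a i j)))"
      by (rule gr.chain_lowers_Fil[where x = "E j" and w = "a i j" and a = "p i powi a i j",
            OF linE wt_E _ serre'[OF False] u]) (simp_all add: p_nz)
    then show ?thesis using a_nonpos[OF False] by simp
  qed (use gr.Fil_E u in simp)
  moreover have "K j u \<in> gr.Fil i c" if u: "u \<in> gr.Fil i c" for u
    using gr.commuting_lowers_Fil[where x = "K j" and w = 0, OF linK _ _ E_K u] wt_K p_nz by simp
  moreover have "Kinv j u \<in> gr.Fil i c" if u: "u \<in> gr.Fil i c" for u
    using gr.commuting_lowers_Fil[where x = "Kinv j" and w = 0, OF linKinv _ _ E_Kinv u] wt_Kinv p_nz by simp
  ultimately show "E j ` gr.Fil i c \<subseteq> gr.Fil i c \<and> K j ` gr.Fil i c \<subseteq> gr.Fil i c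
      \<and> Kinv j ` gr.Fil i c \<subseteq> gr.Fil i c"
    by blast
qed

sublocale bal: balanced sc "p i" "K i" "Kinv i" "E i" for i
proof
  have 1: "span (\<Union>b. gr.wt i b) = UNIV" using wts[of i] by (simp add: gr.wt_def)
  have 2: "gr.wt i b \<noteq> {0} \<Longrightarrow> gr.wt i (- b) \<noteq> {0}" for b using sym[of i b] by (simp add: gr.wt_def)
  have 3: "\<exists>M. \<forall>b. M < \<bar>b\<bar> \<longrightarrow> gr.wt i b = {0}"
    using finite_dim gr.wt_bounded[OF _ _ 1] by blast
  show "gr.Fil i 0 = UNIV" "gr.Fil i (- 1) = {0}"
    using gr.symmetric_imp_balanced[OF 1 nz 3 2 Fil_trivial] by simp_all
  show "\<exists>M. \<forall>b. M < \<bar>b\<bar> \<longrightarrow> gr.wt i b = {0}" by (rule 3)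
qed

end

section \<open>Relations between different indices\<close>

context borel_operators
begin

lemma Kinv_commute:
  assumes "lin x" "c \<noteq> 0" "\<And>v. K i (x v) = sc c (x (K i v))"
  shows "Kinv i (x v) = sc (inverse c) (x (Kinv i v))"
proof -
  have "sc (inverse c) (x (Kinv i v)) = Kinv i (K i (sc (inverse c) (x (Kinv i v))))"
    by (simp add: Kinv_K)
  also have "\<dots> = Kinv i (x v)"
    using assms(2) by (simp add: lin_scale[OF linK] assms(3) K_Kinv)
  finally show ?thesis by simp
qed

text \<open>Only the relations inside each single U_q(sl_2) are demanded. They already determine F,
  and the relations that link different indices are derived from them.\<close>

definition lowering :: "('i \<Rightarrow> 'v \<Rightarrow> 'v) \<Rightarrow> bool" where
  "lowering F \<longleftrightarrow> (\<forall>i. lin (F i) \<and> (\<forall>v. K i (F i v) = sc (p i powi (- 2)) (F i (K i v)))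
     \<and> (\<forall>v. E i (F i v) = F i (E i v) + bal.H i v))"

lemma exists_lowering: "\<exists>F. lowering F"
  using bal.exists_F unfolding lowering_def by metis

lemma
  assumes "lowering F"
  shows lowering_lin: "lin (F i)"
    and lowering_K: "K i (F i v) = sc (p i powi (- 2)) (F i (K i v))"
    and lowering_E: "E i (F i v) = F i (E i v) + bal.H i v"
  using assms by (simp_all add: lowering_def)

lemma lowering_unique:
  assumes "lowering F" "lowering F'"
  shows "F = F'"
proof (intro ext)
  fix i v
  show "F i v = F' i v"
    by (rule bal.F_unique[where i = i and F = "F i" and F' = "F' i"])
      (use assms in \<open>simp_all add: lowering_lin lowering_K lowering_E\<close>)
qed

lemma H_K: "bal.H i (K j v) = K j (bal.H i v)"
  unfolding bal.H_def lin_scale[OF linK] lin_diff[OF linK] Kinv_K_comm K_comm[of i j] ..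

text \<open>The conjugate of F_i by K_j, suitably rescaled, satisfies the same two conditions as F_i
  and therefore equals F_i.\<close>

lemma lowering_K_other:
  assumes F: "lowering F"
  shows "K j (F i v) = sc (p j powi (- a j i)) (F i (K j v))"
proof -
  define F' where "F' = (\<lambda>v. sc (p j powi a j i) (K j (F i (Kinv j v))))"
  note linF = lowering_lin[OF F]
  have "F' u = F i u" for u
  proof (rule bal.F_unique[where i = i and F = F' and F' = "F i"])
    show "lin F'"
      unfolding F'_def by (rule lin_smult[OF lin_comp[OF linK lin_comp[OF linF linKinv]]])
    show "K i (F' v) = sc (p i powi (- 2)) (F' (K i v))" for v
    proof -
      have "K i (F' v) = sc (p j powi a j i) (K j (K i (F i (Kinv j v))))"
        by (simp only: F'_def lin_scale[OF linK] K_comm[of i j])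
      also have "\<dots> = sc (p i powi (- 2)) (F' (K i v))"
        by (simp only: F'_def lin_scale[OF linK] lowering_K[OF F] Kinv_K_comm scale_scale mult.commute)
      finally show ?thesis .
    qed
    show "E i (F' v) - F' (E i v) = E i (F i v) - F i (E i v)" for v
    proof -
      have "E i (F' v) = K j (E i (F i (Kinv j v)))"
        using p_nz[of j] by (simp add: F'_def lin_scale[OF linE] E_K power_int_minus)
      moreover have "F' (E i v) = K j (F i (E i (Kinv j v)))"
        using p_nz[of j] by (simp add: F'_def Kinv_E lin_scale[OF linF] lin_scale[OF linK] power_int_minus)
      ultimately have "E i (F' v) - F' (E i v) = K j (bal.H i (Kinv j v))"
        by (simp add: lowering_E[OF F] lin_add[OF linK])
      also have "\<dots> = bal.H i v" by (simp add: H_K[symmetric] K_Kinv)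
      finally show ?thesis by (simp add: lowering_E[OF F])
    qed
  qed (use F in \<open>simp_all add: lowering_lin lowering_K\<close>)
  from this[of "K j v"] have "sc (p j powi a j i) (K j (F i v)) = F i (K j v)"
    by (simp add: F'_def Kinv_K)
  then have "sc (p j powi (- a j i)) (F i (K j v)) = sc (p j powi (- a j i)) (sc (p j powi a j i) (K j (F i v)))"
    by simp
  then show ?thesis using p_nz[of j] by (simp add: power_int_minus)
qed

lemma lowering_Kinv_other:
  assumes F: "lowering F"
  shows "Kinv j (F i v) = sc (p j powi a j i) (F i (Kinv j v))"
  using Kinv_commute[OF lowering_lin[OF F] _ lowering_K_other[OF F], of j i v] p_nz[of j]
  by (simp add: power_int_minus)

text \<open>Applying F_i to the Serre relation for E_i and E_j shows that D, the commutator of F_i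
  and E_j, is killed by a chain of 1 - A_ij steps. As D has weight A_ij - 2, its string has centre
  -2.\<close>

lemma lowering_E_other:
  assumes F: "lowering F" and ij: "i \<noteq> j"
  shows "E j (F i v) = F i (E j v)"
proof -
  define m where "m = nat (- a i j)"
  have m: "int m = - a i j" using a_nonpos[OF ij] by (simp add: m_def)
  note linF = lowering_lin[OF F]
  define D where "D = (\<lambda>v. F i (E j v) - E j (F i v))"
  have linD: "lin D" unfolding D_def by (rule lin_minus[OF lin_comp[OF linF linE] lin_comp[OF linE linF]])
  define l where "l t = p i powi (2 * int t - int m)" for t
  have l: "l = (\<lambda>t. p i powi (2 * int t + a i j))"
    by (simp add: l_def m fun_eq_iff)
  have zero: "chain (E i) l (E j) (Suc m) v = 0" for v
    unfolding l m_def by (rule serre[OF ij])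
  \<comment> \<open>Here F_i is moved past E_i, which reverses the sign of the commutator; hence
    \<open>K i\<close> and \<open>Kinv i\<close> trade places in
    \<open>chain_commutator_top\<close>.\<close>
  have "F i (chain (E i) l (E j) (Suc m) v)
      = chain (E i) l (E j) (Suc m) (F i v) + chain (E i) l D (Suc m) v" for v
  proof (rule chain_commutator_top[where Z = "F i" and Y = "E i" and y = "E j" and K = "Kinv i"
        and K' = "K i" and p = "p i" and h = "1 / (p i - inverse (p i))" and m = m and d = D and l = l,
        OF linF linE linE linKinv linK p_nz])
    show "F i (E i v) = E i (F i v) + sc (1 / (p i - inverse (p i))) (Kinv i v - K i v)" for v
      by (simp add: lowering_E[OF F] bal.H_def scale_right_diff_distrib)
    show "Kinv i (E i v) = sc (p i powi (- 2)) (E i (Kinv i v))" for v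
      using Kinv_E[of i i v] by (simp only: a_diag)
    show "K i (E i v) = sc (p i powi 2) (E i (K i v))" for v
      using K_E[of i i v] by (simp only: a_diag)
    show "Kinv i (E j v) = sc (p i powi int m) (E j (Kinv i v))" for v
      unfolding m by (rule Kinv_E)
    show "K i (E j v) = sc (p i powi (- int m)) (E j (K i v))" for v
      unfolding m by (simp add: K_E)
  qed (simp_all add: D_def l_def)
  then have chainD: "chain (E i) l D (Suc m) v = 0" for v
    by (simp only: zero lin_0[OF linF] add_0_left)
  have KD: "K i (D v) = sc (p i powi (a i j - 2)) (D (K i v))" for v
  proof -
    have *: "p i powi (a i j - 2) = p i powi (- 2) * p i powi a i j"
      using p_nz[of i] by (simp add: power_int_diff power_int_minus divide_inverse)
    show ?thesis
      by (simp only: D_def lin_diff[OF linK] lin_scale[OF linE] lin_scale[OF linF] lowering_K[OF F] K_E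
          scale_scale * scale_right_diff_distrib mult.commute)
  qed
  have l': "l = (\<lambda>t. p i powi (- int m) * (p i ^ 2) ^ t)"
  proof
    fix t
    have "p i powi (2 * int t) = (p i ^ 2) ^ t"
      by (metis power_int_mult power_int_of_nat power_int_numeral)
    then show "l t = p i powi (- int m) * (p i ^ 2) ^ t"
      using p_nz[of i] by (simp add: l_def power_int_diff power_int_minus divide_inverse mult.commute)
  qed
  have "D v = 0"
    by (rule bal.chain_zero[where i = i and x = D and w = "a i j - 2" and N = m
          and a = "p i powi (- int m)", OF linD gr.wt_shift[OF linD KD]])
      (use p_nz chainD[unfolded l'] in \<open>simp_all add: m del: chain.simps\<close>)
  then show ?thesis by (simp add: D_def)
qed

text \<open>F_j commutes with E_i, so by \<open>chain_commutator_top\<close> the whole Serre element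
  D commutes with E_i. Its weight is -2 (m + 1) + m = -m - 2 with m = -A_ij, which is
  negative.\<close>

lemma lowering_serre:
  assumes F: "lowering F" and ij: "i \<noteq> j"
  shows "chain (F i) (\<lambda>t. p i powi (2 * int t + a i j)) (F j) (Suc (nat (- a i j))) v = 0"
proof -
  define m where "m = nat (- a i j)"
  have m: "int m = - a i j" using a_nonpos[OF ij] by (simp add: m_def)
  note linF = lowering_lin[OF F]
  define l where "l t = p i powi (2 * int t - int m)" for t
  have l: "l = (\<lambda>t. p i powi (2 * int t + a i j))"
    by (simp add: l_def m fun_eq_iff)
  define D where "D = chain (F i) l (F j) (Suc m)"
  have linD: "lin D" unfolding D_def by (rule lin_chain[OF linF linF])
  have KF: "K i (F i v) = sc (p i powi (- 2)) (F i (K i v))" for v by (rule lowering_K[OF F])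
  have KFj: "K i (F j v) = sc (p i powi int m) (F j (K i v))" for v
    unfolding m by (rule lowering_K_other[OF F])
  have "E i (D v) = D (E i v) + chain (F i) l (\<lambda>v. 0) (Suc m) v" for v
    unfolding D_def
  proof (rule chain_commutator_top[where Z = "E i" and Y = "F i" and y = "F j" and K = "K i"
        and K' = "Kinv i" and p = "p i" and h = "1 / (p i - inverse (p i))" and m = m
        and d = "\<lambda>v. 0" and l = l,
        OF linE linF linF linK linKinv p_nz _ KF _ KFj])
    show "E i (F i v) = F i (E i v) + sc (1 / (p i - inverse (p i))) (K i v - Kinv i v)" for v
      by (simp add: lowering_E[OF F] bal.H_def)
    show "Kinv i (F i v) = sc (p i powi 2) (F i (Kinv i v))" for v
      using lowering_Kinv_other[OF F, of i i v] by (simp only: a_diag)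
    show "Kinv i (F j v) = sc (p i powi (- int m)) (F j (Kinv i v))" for v
      unfolding m using lowering_Kinv_other[OF F, of i j v] by simp
    show "0 = E i (F j v) - F j (E i v)" for v
      using lowering_E_other[OF F, of j i v] ij by simp
  qed (simp add: l_def)
  then have comm: "E i (D v) = sc 1 (D (E i v))" for v
    by (simp only: chain_of_zero[OF linF] add_0_right scale_one)
  have KD: "K i (D v) = sc (p i powi (- int m - 2)) (D (K i v))" for v
  proof -
    have "(p i powi (- 2)) ^ Suc m * p i powi int m = p i powi (- int m - 2)"
    proof -
      have "(p i powi (- 2)) ^ Suc m = p i powi (- 2 * int (Suc m))"
        by (simp only: power_int_mult power_int_of_nat)
      then have "(p i powi (- 2)) ^ Suc m * p i powi int m = p i powi (- 2 * int (Suc m) + int m)"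
        using p_nz[of i] by (simp only: power_int_add simp_thms)
      also have "- 2 * int (Suc m) + int m = - int m - 2" by simp
      finally show ?thesis .
    qed
    then show ?thesis
      unfolding D_def using chain_weight[OF linK linF linF KF KFj, of l "Suc m" v] by (simp only:)
  qed
  have "D v = 0"
    by (rule bal.commuting_zero[where i = i and x = D and w = "- int m - 2" and a = 1,
          OF linD gr.wt_shift[OF linD KD] _ comm]) simp_all
  then show ?thesis by (simp add: D_def l m_def)
qed

end

section \<open>Modules over a presented algebra\<close>

lemma free_ring_simps [simp]:
  "carrier (free_ring :: ('g, 'f::field) free_alg ring) = UNIV"
  "mult (free_ring :: ('g, 'f) free_alg ring) = (*)"
  "add (free_ring :: ('g, 'f) free_alg ring) = (+)"
  "one (free_ring :: ('g, 'f) free_alg ring) = 1"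
  "zero (free_ring :: ('g, 'f) free_alg ring) = 0"
  by (simp_all add: ring_of_type_algebra_def)

lemma ideal_genideal: "ideal (genideal free_ring R) (free_ring :: ('g, 'f::field) free_alg ring)"
  by (rule ring.genideal_ideal[OF ring_free_ring]) simp

lemma cls_ring_hom: "cls R \<in> ring_hom free_ring (presented R)"
  using ideal.rcos_ring_hom[OF ideal_genideal[of R]]
  by (simp add: cls_def[abs_def] presented_def)

lemma
  shows cls_add: "cls R (x + y) = cls R x \<oplus>\<^bsub>presented R\<^esub> cls R y"
    and cls_mult: "cls R (x * y) = cls R x \<otimes>\<^bsub>presented R\<^esub> cls R y"
    and cls_one: "cls R 1 = \<one>\<^bsub>presented R\<^esub>"
    and cls_carrier: "cls R x \<in> carrier (presented R)"
  using ring_hom_add[OF cls_ring_hom, of x y R] ring_hom_mult[OF cls_ring_hom, of x y R]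
    ring_hom_one[OF cls_ring_hom, of R] ring_hom_closed[OF cls_ring_hom, of x R]
  by simp_all

lemma carrier_presented: "C \<in> carrier (presented R) \<longleftrightarrow> (\<exists>x. C = cls R x)"
  by (auto simp: presented_def cls_def FactRing_def A_RCOSETS_def')

lemma cls_relation:
  assumes "r \<in> R"
  shows "cls R r = cls R 0"
proof -
  interpret I: ideal "genideal free_ring R" free_ring by (rule ideal_genideal)
  have "r \<in> genideal free_ring R"
    using ring.genideal_self[OF ring_free_ring, of R] assms by auto
  moreover have "0 \<in> genideal free_ring R"
    using additive_subgroup.zero_closed[OF ideal.axioms(1)[OF ideal_genideal[of R]]] by simp
  ultimately show ?thesis unfolding cls_def using I.a_rcos_const by simp
qed

lemma cls_eqD:
  assumes "cls R x = cls R y"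
  shows "x - y \<in> genideal free_ring R"
proof -
  interpret I: ideal "genideal free_ring R" free_ring by (rule ideal_genideal)
  have "x \<in> genideal free_ring R +>\<^bsub>free_ring\<^esub> x"
    by (rule I.a_rcos_self) simp
  then have "x \<in> genideal free_ring R +>\<^bsub>free_ring\<^esub> y"
    using assms by (simp add: cls_def)
  then obtain h where "h \<in> genideal free_ring R" "x = h + y"
    by (auto simp: a_r_coset_def')
  then show ?thesis by simp
qed

lemma free_alg_induct [case_names scalar gen add mult]:
  fixes x :: "('g, 'f::field) free_alg"
  assumes scalar: "\<And>c. P (scalar c)" and gen: "\<And>g. P (gen g)"
    and add: "\<And>x y. P x \<Longrightarrow> P y \<Longrightarrow> P (x + y)" and mult: "\<And>x y. P x \<Longrightarrow> P y \<Longrightarrow> P (x * y)"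
  shows "P x"
proof -
  have word: "P (Poly_Mapping.single (Word gs) c)" for gs and c :: 'f
  proof (induction gs)
    case Nil
    then show ?case using scalar[of c] by (simp add: scalar_def zero_word_def)
  next
    case (Cons g gs)
    have "Poly_Mapping.single (Word (g # gs)) c = gen g * Poly_Mapping.single (Word gs) c"
      by (simp add: gen_def mult_single plus_word_def)
    then show ?case using mult[OF gen Cons] by simp
  qed
  show ?thesis
  proof (induction x rule: update_induct)
    case const
    then show ?case using scalar[of 0] by (simp add: scalar_def)
  next
    case (update f a b)
    have "Poly_Mapping.update a b f = f + Poly_Mapping.single a b"
      using update.hyps by (intro poly_mapping_eqI) (auto simp: lookup_update lookup_add lookup_single in_keys_iff when_def)
    then show ?case using add[OF update.IH word[of "letters a" b]] by simp
  qed
qed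

section \<open>Evaluation of the free algebra on operators\<close>

context scalars
begin

definition wact :: "('g \<Rightarrow> 'v \<Rightarrow> 'v) \<Rightarrow> 'g word \<Rightarrow> 'v \<Rightarrow> 'v" where
  "wact act w v = foldr act (letters w) v"

definition ev :: "('g \<Rightarrow> 'v \<Rightarrow> 'v) \<Rightarrow> ('g, 'f) free_alg \<Rightarrow> 'v \<Rightarrow> 'v" where
  "ev act x v = (\<Sum>w\<in>Poly_Mapping.keys x. sc (Poly_Mapping.lookup x w) (wact act w v))"

lemma ev_superset:
  assumes "finite S" "Poly_Mapping.keys x \<subseteq> S"
  shows "ev act x v = (\<Sum>w\<in>S. sc (Poly_Mapping.lookup x w) (wact act w v))"
  unfolding ev_def using assms
  by (intro sum.mono_neutral_left) (auto simp: in_keys_iff)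

lemma ev_add: "ev act (x + y) v = ev act x v + ev act y v"
proof -
  define S where "S = Poly_Mapping.keys x \<union> Poly_Mapping.keys y"
  have S: "finite S" "Poly_Mapping.keys (x + y) \<subseteq> S" "Poly_Mapping.keys x \<subseteq> S" "Poly_Mapping.keys y \<subseteq> S"
    using Poly_Mapping.keys_add[of x y] by (auto simp: S_def)
  show ?thesis
    unfolding S(2-4)[THEN ev_superset[OF S(1)]]
    by (simp add: lookup_add scale_left_distrib sum.distrib)
qed

lemma ev_single: "ev act (Poly_Mapping.single w c) v = sc c (wact act w v)"
  by (subst ev_superset[of "{w}"]) auto

lemma ev_zero: "ev act 0 v = 0"
  by (simp add: ev_def)

lemma ev_minus: "ev act (- x) v = - ev act x v"
  using ev_add[of act x "- x" v] by (simp add: ev_zero eq_neg_iff_add_eq_0 add.commute)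

lemma ev_diff: "ev act (x - y) v = ev act x v - ev act y v"
  using ev_add[of act x "- y" v] by (simp add: ev_minus)

lemma ev_sum: "ev act (sum f I) v = (\<Sum>i\<in>I. ev act (f i) v)"
  by (induction I rule: infinite_finite_induct) (simp_all add: ev_zero ev_add)

lemma wact_plus: "wact act (w + w') v = wact act w (wact act w' v)"
  by (simp add: wact_def plus_word_def)

lemma ev_scalar: "ev act (scalar c) v = sc c v"
  by (simp add: scalar_def ev_single wact_def zero_word_def)

lemma ev_one: "ev act 1 v = v"
  using ev_scalar[of act 1 v] by (simp add: scalar_def)

lemma ev_gen: "ev act (gen g) v = act g v"
  by (simp add: gen_def ev_single wact_def)

context
  fixes act :: "'g \<Rightarrow> 'v \<Rightarrow> 'v"
  assumes act: "\<And>g. lin (act g)"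
begin

lemma lin_wact: "lin (wact act w)"
proof -
  have "lin (foldr act gs)" for gs
    by (induction gs) (simp_all add: lin_iff lin_simps[OF act])
  then show ?thesis by (simp add: wact_def[abs_def])
qed

lemma lin_ev: "lin (ev act x)"
  unfolding lin_iff ev_def
  by (simp add: lin_simps[OF lin_wact] scale_right_distrib sum.distrib scale_sum_right mult.commute)

lemma ev_mult: "ev act (x * y) v = ev act x (ev act y v)"
proof -
  have single: "ev act (Poly_Mapping.single w c * y) v = ev act (Poly_Mapping.single w c) (ev act y v)" for w c y
  proof (induction y rule: update_induct)
    case const
    then show ?case by (simp add: ev_zero lin_0[OF lin_ev])
  next
    case (update f a b)
    have "Poly_Mapping.update a b f = f + Poly_Mapping.single a b"
      using update.hyps by (intro poly_mapping_eqI) (auto simp: lookup_update lookup_add lookup_single in_keys_iff when_def)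
    then show ?case
      by (simp add: distrib_left ev_add update.IH lin_add[OF lin_ev])
        (simp add: mult_single ev_single wact_plus lin_scale[OF lin_wact])
  qed
  show ?thesis
  proof (induction x rule: update_induct)
    case const
    then show ?case by (simp add: ev_zero)
  next
    case (update f a b)
    have "Poly_Mapping.update a b f = f + Poly_Mapping.single a b"
      using update.hyps by (intro poly_mapping_eqI) (auto simp: lookup_update lookup_add lookup_single in_keys_iff when_def)
    then show ?case by (simp add: distrib_right ev_add update.IH single)
  qed
qed

lemma ev_kernel_ideal: "ideal {x. \<forall>v. ev act x v = 0} (free_ring :: ('g, 'f) free_alg ring)"
proof (rule idealI[OF ring_free_ring])
  interpret R: ring "free_ring :: ('g, 'f) free_alg ring" by (rule ring_free_ring)
  have inv: "inv\<^bsub>add_monoid free_ring\<^esub> x = - x" for x :: "('g, 'f) free_alg"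
    using R.add.inv_equality[of "- x" x] by (simp add: a_inv_def)
  show "subgroup {x. \<forall>v. ev act x v = 0} (add_monoid (free_ring :: ('g, 'f) free_alg ring))"
    by (rule subgroup.intro) (simp_all add: ev_add ev_zero inv[simplified] ev_minus)
qed (simp_all add: ev_mult lin_0[OF lin_ev])

text \<open>The universal property of the presented algebra: the kernel of \<open>ev\<close> is a
  two-sided ideal that contains R, so \<open>ev\<close> is constant on the residue classes.\<close>

lemma exists_module_structure:
  assumes R: "\<And>r v. r \<in> R \<Longrightarrow> ev act r v = 0"
  shows "\<exists>\<rho>. module_structure sc R \<rho> \<and> (\<forall>g. \<rho> (cls R (gen g)) = act g)"
proof -
  \<comment> \<open>The choice of a representative is immaterial by \<open>eq\<close> below;
    \<open>restrict\<close> provides the extensionality required of a module structure.\<close>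
  define \<rho> where "\<rho> = restrict (\<lambda>C. ev act (SOME x. C = cls R x)) (carrier (presented R))"
  have "genideal free_ring R \<subseteq> {x. \<forall>v. ev act x v = 0}"
    using R by (intro ring.genideal_minimal[OF ring_free_ring ev_kernel_ideal]) auto
  then have eq: "ev act x = ev act y" if "cls R x = cls R y" for x y
    using cls_eqD[OF that] by (auto simp: ev_diff fun_eq_iff)
  have \<rho>: "\<rho> (cls R x) = ev act x" for x
  proof -
    have "cls R x = cls R (SOME y. cls R x = cls R y)" by (rule someI[of _ x]) simp
    from eq[OF this] show ?thesis by (simp add: \<rho>_def cls_carrier)
  qed
  have "\<rho> \<in> ring_hom (presented R) (End_ring sc)"
  proof (rule ring_hom_memI)
    show "\<rho> C \<in> carrier (End_ring sc)" if "C \<in> carrier (presented R)" for C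
      using that lin_ev by (auto simp: carrier_presented \<rho> End_ring_def)
    show "\<rho> (C \<otimes>\<^bsub>presented R\<^esub> D) = \<rho> C \<otimes>\<^bsub>End_ring sc\<^esub> \<rho> D"
      "\<rho> (C \<oplus>\<^bsub>presented R\<^esub> D) = \<rho> C \<oplus>\<^bsub>End_ring sc\<^esub> \<rho> D"
      if "C \<in> carrier (presented R)" "D \<in> carrier (presented R)" for C D
      using that by (auto simp: carrier_presented cls_mult[symmetric] cls_add[symmetric] \<rho>
          End_ring_def ev_mult ev_add fun_eq_iff)
    show "\<rho> \<one>\<^bsub>presented R\<^esub> = \<one>\<^bsub>End_ring sc\<^esub>"
      by (simp add: cls_one[symmetric] \<rho> End_ring_def ev_one fun_eq_iff)
  qed
  then have "module_structure sc R \<rho>"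
    unfolding module_structure_def using \<rho>
    by (simp add: ev_scalar fun_eq_iff) (simp add: \<rho>_def)
  moreover have "\<forall>g. \<rho> (cls R (gen g)) = act g"
    by (simp add: \<rho> ev_gen fun_eq_iff)
  ultimately show ?thesis by blast
qed

end

context
  fixes R :: "('g, 'f) free_alg set" and \<rho>
  assumes ms: "module_structure sc R \<rho>"
begin

lemma ms_hom: "\<rho> \<in> ring_hom (presented R) (End_ring sc)"
  using ms by (simp add: module_structure_def)

lemma
  shows ms_add: "\<rho> (cls R (x + y)) v = \<rho> (cls R x) v + \<rho> (cls R y) v"
    and ms_mult: "\<rho> (cls R (x * y)) v = \<rho> (cls R x) (\<rho> (cls R y) v)"
    and ms_lin: "lin (\<rho> (cls R x))"
  using ring_hom_add[OF ms_hom cls_carrier cls_carrier, of x y]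
    ring_hom_mult[OF ms_hom cls_carrier cls_carrier, of x y]
    ring_hom_closed[OF ms_hom cls_carrier, of x]
  by (simp_all add: cls_add cls_mult End_ring_def)

lemma ms_scalar: "\<rho> (cls R (scalar c)) v = sc c v"
  using ms by (simp add: module_structure_def)

lemma ms_ev: "\<rho> (cls R x) v = ev (\<lambda>g. \<rho> (cls R (gen g))) x v"
proof (induction x arbitrary: v rule: free_alg_induct)
  case (mult x y)
  then show ?case by (simp add: ms_mult ev_mult[OF ms_lin])
qed (simp_all add: ms_scalar ev_scalar ev_gen ms_add ev_add)

lemma ms_relation:
  assumes "r \<in> R"
  shows "ev (\<lambda>g. \<rho> (cls R (gen g))) r v = 0"
  using cls_relation[OF assms] ms_ev[of r v] ms_ev[of 0 v] by (simp add: ev_zero)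

lemma ms_invariant:
  assumes W: "subspace W" and gens: "\<And>g. \<rho> (cls R (gen g)) ` W \<subseteq> W" and u: "u \<in> carrier (presented R)"
  shows "\<rho> u ` W \<subseteq> W"
proof -
  have "\<forall>w\<in>W. \<rho> (cls R x) w \<in> W" for x
  proof (induction x rule: free_alg_induct)
    case (gen g)
    then show ?case using gens by blast
  qed (simp_all add: ms_scalar ms_add ms_mult subspace_scale[OF W] subspace_add[OF W])
  then show ?thesis using u by (auto simp: carrier_presented)
qed

end

lemma module_structure_unique:
  assumes "module_structure sc R \<rho>" "module_structure sc R \<rho>'"
    and "\<And>g. \<rho> (cls R (gen g)) = \<rho>' (cls R (gen g))"
  shows "\<rho> = \<rho>'"
proof (rule extensionalityI)
  show "\<rho> \<in> extensional (carrier (presented R))" "\<rho>' \<in> extensional (carrier (presented R))"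
    using assms(1,2) by (auto simp: module_structure_def)
  show "\<rho> C = \<rho>' C" if "C \<in> carrier (presented R)" for C
    using that by (auto simp: carrier_presented fun_eq_iff ms_ev[OF assms(1)] ms_ev[OF assms(2)] assms(3))
qed

end

section \<open>The quantum binomial theorem and the Serre relations\<close>

lemma qfact_Suc: "qfact p (Suc n) = qfact p n * qint p (Suc n)"
  by (simp add: qfact_def)

lemma qfact_0: "qfact p 0 = 1"
  by (simp add: qfact_def)

lemma qint_nonzero:
  fixes p :: "'f::field"
  assumes "p \<noteq> 0" "\<And>k. k > 0 \<Longrightarrow> p ^ k \<noteq> 1" "k > 0"
  shows "qint p k \<noteq> 0"
proof -
  have *: "p ^ k - inverse p ^ k \<noteq> 0" if "k > 0" for k
  proof
    assume "p ^ k - inverse p ^ k = 0"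
    then have "p ^ k * p ^ k = inverse p ^ k * p ^ k" by simp
    then have "p ^ (k + k) = 1"
      using assms(1) by (simp add: power_add power_mult_distrib[symmetric])
    then show False using assms(2)[of "k + k"] that by simp
  qed
  show ?thesis using *[of k] *[of 1] assms(3) by (simp add: qint_def)
qed

lemma qfact_nonzero:
  fixes p :: "'f::field"
  assumes "p \<noteq> 0" "\<And>k. k > 0 \<Longrightarrow> p ^ k \<noteq> 1"
  shows "qfact p k \<noteq> 0"
  using qint_nonzero[OF assms] by (simp add: qfact_def)

lemma qint_add:
  fixes p :: "'f::field"
  assumes "p \<noteq> 0"
  shows "p ^ r * qint p (d + r) = qint p d + p ^ (d + r) * qint p r"
proof -
  have inv: "p ^ r * inverse p ^ r = 1" "p ^ r * (inverse p ^ r * x) = x" for r x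
    using assms by (simp_all add: power_mult_distrib[symmetric] mult.assoc[symmetric])
  have "p ^ r * (p ^ (d + r) - inverse p ^ (d + r))
      = p ^ d - inverse p ^ d + p ^ (d + r) * (p ^ r - inverse p ^ r)"
    by (simp add: power_add algebra_simps inv)
  then show ?thesis
    unfolding qint_def times_divide_eq_right add_divide_distrib[symmetric] by simp
qed

text \<open>All three binomials are multiples of \<open>c\<close> by the quantum integers that
  \<open>qint_add\<close> relates. The power of p on the left avoids negative exponents, and d
  replaces a truncated difference.\<close>

lemma qbinom_Pascal:
  fixes p :: "'f::field"
  assumes p: "p \<noteq> 0" "\<And>k. k > 0 \<Longrightarrow> p ^ k \<noteq> 1"
  shows "p ^ Suc r * qbinom p (Suc (Suc r + d)) (Suc r)
    = qbinom p (Suc r + d) (Suc r) + p ^ (Suc d + Suc r) * qbinom p (Suc r + d) r"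
proof -
  define c where "c = qfact p (Suc r + d) / (qfact p (Suc r) * qfact p (Suc d))"
  note nz = qint_nonzero[OF p] qfact_nonzero[OF p]
  have "qbinom p (Suc (Suc r + d)) (Suc r) = c * qint p (Suc d + Suc r)"
    by (simp add: qbinom_def c_def qfact_Suc[of p "Suc (d + r)"] add.commute)
  moreover have "qbinom p (Suc r + d) (Suc r) = c * qint p (Suc d)"
    using nz by (simp add: qbinom_def c_def qfact_Suc[of p d])
  moreover have "qbinom p (Suc r + d) r = c * qint p (Suc r)"
    using nz by (simp add: qbinom_def c_def qfact_Suc[of p r] Suc_diff_le)
  ultimately show ?thesis
    using arg_cong[OF qint_add[OF p(1), of "Suc r" "Suc d"], of "\<lambda>x. c * x"]
    by (simp only: distrib_left mult_ac)
qed

lemma qbinom_ends: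
  fixes p :: "'f::field"
  assumes "p \<noteq> 0" "\<And>k. k > 0 \<Longrightarrow> p ^ k \<noteq> 1"
  shows "qbinom p n 0 = 1" "qbinom p n n = 1"
  using qfact_nonzero[OF assms] by (simp_all add: qbinom_def qfact_0)

text \<open>Gauss's binomial formula in base p^2; the power p^(r (n-1)) comes from the symmetric
  normalization of the quantum integers. The induction splits off the last linear factor and uses
  \<open>qbinom_Pascal\<close>.\<close>

lemma qbinomial_theorem:
  fixes p b :: "'f::field"
  assumes p: "p \<noteq> 0" "\<And>k. k > 0 \<Longrightarrow> p ^ k \<noteq> 1" and "r \<le> n"
  shows "poly.coeff (\<Prod>t<n. [:- (b * p ^ (2 * t)), 1:]) (n - r)
    = (- b) ^ r * p ^ (r * (n - 1)) * qbinom p n r"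
  using assms(3)
proof (induction n arbitrary: r)
  case 0
  then show ?case by (simp add: qbinom_ends[OF p])
next
  case (Suc n)
  define P where "P = (\<Prod>t<n. [:- (b * p ^ (2 * t)), 1:])"
  have deg: "Polynomial.degree P = n"
    unfolding P_def by (subst degree_prod_eq_sum_degree) auto
  have PS: "(\<Prod>t<Suc n. [:- (b * p ^ (2 * t)), 1:]) = pCons 0 P - Polynomial.smult (b * p ^ (2 * n)) P"
    by (simp add: P_def mult.commute)
  have IH: "poly.coeff P (n - r) = (- b) ^ r * p ^ (r * (n - 1)) * qbinom p n r" if "r \<le> n" for r
    using Suc.IH[OF that] by (simp add: P_def)
  show ?case
  proof (cases r)
    case 0
    then show ?thesis
      using IH[of 0] deg unfolding PS by (simp add: qbinom_ends[OF p] coeff_eq_0)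
  next
    case r: (Suc r')
    show ?thesis
    proof (cases "r = Suc n")
      case True
      have "2 * n + n * (n - 1) = Suc n * n" by (cases n) simp_all
      then have "p ^ (2 * n) * p ^ (n * (n - 1)) = p ^ (Suc n * n)"
        by (simp only: power_add[symmetric])
      then show ?thesis
        using IH[of n] True unfolding PS by (simp add: qbinom_ends[OF p] mult_ac)
    next
      case False
      then obtain d where n: "n = Suc r' + d"
        using Suc.prems r by (metis le_SucE le_Suc_ex)
      have "r * n = r * (n - 1) + Suc r'" by (simp add: r n)
      then have 1: "p ^ (r * n) = p ^ (r * (n - 1)) * p ^ Suc r'"
        by (simp only: power_add[symmetric])
      have "r * (n - 1) + (Suc d + Suc r') = 2 * n + r' * (n - 1)" by (simp add: r n)
      then have 2: "p ^ (r * (n - 1)) * p ^ (Suc d + Suc r') = p ^ (2 * n) * p ^ (r' * (n - 1))"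
        by (simp only: power_add[symmetric])
      have pascal: "p ^ Suc r' * qbinom p (Suc n) r
          = qbinom p n r + p ^ (Suc d + Suc r') * qbinom p n r'"
        using qbinom_Pascal[where p = p and r = r' and d = d, OF p] by (simp only: r n)
      have "(- b) ^ r * p ^ (r * n) * qbinom p (Suc n) r
          = (- b) ^ r * p ^ (r * (n - 1)) * (p ^ Suc r' * qbinom p (Suc n) r)"
        unfolding 1 by (simp only: mult_ac)
      also have "\<dots> = (- b) ^ r * p ^ (r * (n - 1)) * qbinom p n r
          + (- b) ^ r * (p ^ (r * (n - 1)) * p ^ (Suc d + Suc r')) * qbinom p n r'"
        unfolding pascal by (simp only: distrib_left mult_ac)
      also have "\<dots> = poly.coeff P (n - r) - b * p ^ (2 * n) * poly.coeff P (n - r')"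
        using IH[of r] IH[of r'] unfolding 2 by (simp add: r n mult_ac)
      also have "\<dots> = poly.coeff (\<Prod>t<Suc n. [:- (b * p ^ (2 * t)), 1:]) (Suc n - r)"
        unfolding PS by (simp add: r n)
      finally show ?thesis by simp
    qed
  qed
qed

context scalars
begin

lemma chain_scale:
  assumes "lin Y" "lin x"
  shows "chain (\<lambda>v. sc c (Y v)) l (\<lambda>v. sc d (x v)) t v = sc (c ^ t * d) (chain Y l x t v)"
proof (induction t arbitrary: v)
  case (Suc t)
  show ?case
    by (simp only: chain.simps Suc lin_simps[OF assms(1)] lin_simps[OF lin_chain[OF assms]]
        scale_scale scale_right_diff_distrib power_Suc mult_ac)
qed simp

lemma ev_power:
  assumes "\<And>g. lin (act g)"
  shows "ev act (gen g ^ n) v = (act g ^^ n) v"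
  by (induction n arbitrary: v) (simp_all add: ev_one ev_mult[OF assms] ev_gen)

text \<open>The twists are b p^(2t) with b = p^(-m) and m = -A_ij. For the m + 1 factors of the
  chain the powers b^r and p^(r m) in the binomial formula cancel, and the coefficients of the Serre
  sum remain.\<close>

lemma ev_serre:
  fixes A :: "int^'n^'n::finite"
  assumes act: "\<And>g. lin (act g)"
    and p: "q ^ s i \<noteq> 0" "\<And>k. k > 0 \<Longrightarrow> (q ^ s i) ^ k \<noteq> 1" and A: "A $ i $ j \<le> 0"
  shows "ev act (serre q s A (\<lambda>i. gen (g i)) i j) v =
    chain (act (g i)) (\<lambda>t. (q ^ s i) powi (2 * int t + A $ i $ j)) (act (g j)) (Suc (nat (- A $ i $ j))) v"
proof -
  define m where "m = nat (- A $ i $ j)"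
  have m: "nat (1 - A $ i $ j) = Suc m" "int m = - A $ i $ j" using A by (simp_all add: m_def)
  define p where "p = q ^ s i"
  note p = p[folded p_def]
  define b where "b = inverse (p ^ m)"
  have l: "(\<lambda>t. p powi (2 * int t + A $ i $ j)) = (\<lambda>t. b * p ^ (2 * t))"
  proof
    fix t
    have "p powi (2 * int t) = p ^ (2 * t)"
      by (metis of_nat_mult of_nat_numeral power_int_of_nat)
    moreover have "2 * int t + A $ i $ j = 2 * int t - int m" using m(2) by simp
    ultimately show "p powi (2 * int t + A $ i $ j) = b * p ^ (2 * t)"
      using p(1) by (simp add: b_def power_int_diff divide_inverse mult.commute)
  qed
  have coeff: "poly.coeff (\<Prod>t<Suc m. [:- (b * p ^ (2 * t)), 1:]) (Suc m - r)
      = (- 1) ^ r * qbinom p (Suc m) r" if "r \<le> Suc m" for r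
  proof -
    have "(- b) ^ r * p ^ (r * m) = (- 1) ^ r"
      using p(1) by (simp add: b_def power_minus[of "inverse (p ^ m)"] power_inverse power_mult[symmetric] mult.commute)
    then show ?thesis using qbinomial_theorem[OF p that, of b] by simp
  qed
  have "chain (act (g i)) (\<lambda>t. b * p ^ (2 * t)) (act (g j)) (Suc m) v
      = (\<Sum>k\<le>Suc m. sc (poly.coeff (\<Prod>t<Suc m. [:- (b * p ^ (2 * t)), 1:]) k)
          ((act (g i) ^^ k) (act (g j) ((act (g i) ^^ (Suc m - k)) v))))"
    unfolding chain_eq_hsum[OF act] hsum_def ..
  also have "\<dots> = (\<Sum>r\<le>Suc m. sc (poly.coeff (\<Prod>t<Suc m. [:- (b * p ^ (2 * t)), 1:]) (Suc m - r))
          ((act (g i) ^^ (Suc m - r)) (act (g j) ((act (g i) ^^ (Suc m - (Suc m - r))) v))))"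
    unfolding atMost_atLeast0 by (subst sum.atLeastAtMost_rev) (simp only: add_0_right)
  also have "\<dots> = (\<Sum>r\<le>Suc m. sc ((- 1) ^ r * qbinom p (Suc m) r)
          ((act (g i) ^^ (Suc m - r)) (act (g j) ((act (g i) ^^ r) v))))"
  proof (rule sum.cong)
    fix r assume "r \<in> {..Suc m}"
    then have "r \<le> Suc m" by simp
    then show "sc (poly.coeff (\<Prod>t<Suc m. [:- (b * p ^ (2 * t)), 1:]) (Suc m - r))
          ((act (g i) ^^ (Suc m - r)) (act (g j) ((act (g i) ^^ (Suc m - (Suc m - r))) v)))
       = sc ((- 1) ^ r * qbinom p (Suc m) r)
          ((act (g i) ^^ (Suc m - r)) (act (g j) ((act (g i) ^^ r) v)))"
      by (simp only: coeff diff_diff_cancel)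
  qed simp
  also have "\<dots> = ev act (serre q s A (\<lambda>i. gen (g i)) i j) v"
    unfolding serre_def Let_def m p_def[symmetric] ev_sum atMost_atLeast0
    by (simp only: ev_mult[OF act] ev_scalar ev_power[OF act] ev_gen)
  finally show ?thesis unfolding p_def[symmetric] l m_def[symmetric] by simp
qed

end

lemma
  shows ball_setcompr: "(\<forall>r\<in>{f i | i. True}. P r) \<longleftrightarrow> (\<forall>i. P (f i))"
    and ball_setcompr2: "(\<forall>r\<in>{g i j | i j. True}. P r) \<longleftrightarrow> (\<forall>i j. P (g i j))"
    and ball_setcompr2_neq: "(\<forall>r\<in>{h i j | i j. i \<noteq> j}. P r) \<longleftrightarrow> (\<forall>i j. i \<noteq> j \<longrightarrow> P (h i j))"
  by blast+

section \<open>The defining relations as identities between operators\<close>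

context scalars
begin

context
  fixes q :: 'f and s :: "'n::finite \<Rightarrow> nat" and A :: "int^'n^'n"
  assumes p: "\<forall>i. q ^ s i \<noteq> 0" "\<forall>i. \<forall>k>0. (q ^ s i) ^ k \<noteq> 1"
    and A: "\<forall>i j. i \<noteq> j \<longrightarrow> A $ i $ j \<le> 0"
begin

lemma ev_borel_rels:
  assumes act: "\<And>g. lin (act g)"
  shows "(\<forall>r\<in>borel_rels q s A. \<forall>v. ev act r v = 0) \<longleftrightarrow>
    (\<forall>i v. act (k_gen i) (act (kinv_gen i) v) = v) \<and>
    (\<forall>i v. act (kinv_gen i) (act (k_gen i) v) = v) \<and>
    (\<forall>i j v. act (k_gen i) (act (k_gen j) v) = act (k_gen j) (act (k_gen i) v)) \<and>
    (\<forall>i j v. act (k_gen i) (act (e_gen j) (act (kinv_gen i) v)) =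
       sc ((q ^ s i) powi (A $ i $ j)) (act (e_gen j) v)) \<and>
    (\<forall>i j. i \<noteq> j \<longrightarrow> (\<forall>v. chain (act (e_gen i)) (\<lambda>t. (q ^ s i) powi (2 * int t + A $ i $ j))
       (act (e_gen j)) (Suc (nat (- A $ i $ j))) v = 0))"
proof -
  have serre: "ev act (serre q s A (\<lambda>i. gen (e_gen i)) i j) v =
    chain (act (e_gen i)) (\<lambda>t. (q ^ s i) powi (2 * int t + A $ i $ j)) (act (e_gen j)) (Suc (nat (- A $ i $ j))) v"
    if "i \<noteq> j" for i j v
    by (rule ev_serre[OF act]) (use p A that in simp_all)
  show ?thesis
    unfolding borel_rels_def ball_Un ball_setcompr ball_setcompr2 ball_setcompr2_neq conj_assoc
    by (simp only: ev_diff ev_mult[OF act] ev_gen ev_one ev_scalar right_minus_eq serre not_False_eq_True cong: imp_cong)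
qed

lemma ev_uq_rels:
  assumes act: "\<And>g. lin (act g)"
  shows "(\<forall>r\<in>uq_rels q s A. \<forall>v. ev act r v = 0) \<longleftrightarrow>
    (\<forall>i v. act (K_gen i) (act (Kinv_gen i) v) = v) \<and>
    (\<forall>i v. act (Kinv_gen i) (act (K_gen i) v) = v) \<and>
    (\<forall>i j v. act (K_gen i) (act (K_gen j) v) = act (K_gen j) (act (K_gen i) v)) \<and>
    (\<forall>i j v. act (K_gen i) (act (E_gen j) (act (Kinv_gen i) v)) =
       sc ((q ^ s i) powi (A $ i $ j)) (act (E_gen j) v)) \<and>
    (\<forall>i j v. act (K_gen i) (act (F_gen j) (act (Kinv_gen i) v)) =
       sc ((q ^ s i) powi (- A $ i $ j)) (act (F_gen j) v)) \<and>
    (\<forall>i j v. act (E_gen i) (act (F_gen j) v) - act (F_gen j) (act (E_gen i) v) =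
       (if i = j then sc (1 / (q ^ s i - inverse (q ^ s i))) (act (K_gen i) v - act (Kinv_gen i) v) else 0)) \<and>
    (\<forall>i j. i \<noteq> j \<longrightarrow> (\<forall>v. chain (act (E_gen i)) (\<lambda>t. (q ^ s i) powi (2 * int t + A $ i $ j))
       (act (E_gen j)) (Suc (nat (- A $ i $ j))) v = 0)) \<and>
    (\<forall>i j. i \<noteq> j \<longrightarrow> (\<forall>v. chain (act (F_gen i)) (\<lambda>t. (q ^ s i) powi (2 * int t + A $ i $ j))
       (act (F_gen j)) (Suc (nat (- A $ i $ j))) v = 0))"
proof -
  have serre: "ev act (serre q s A (\<lambda>i. gen (g i)) i j) v =
    chain (act (g i)) (\<lambda>t. (q ^ s i) powi (2 * int t + A $ i $ j)) (act (g j)) (Suc (nat (- A $ i $ j))) v"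
    if "i \<noteq> j" for g i j v
    by (rule ev_serre[OF act]) (use p A that in simp_all)
  have ev_if: "ev act (if b then x else 0) v = (if b then ev act x v else 0)" for b x v
    by (simp add: ev_zero)
  show ?thesis
    unfolding uq_rels_def ball_Un ball_setcompr ball_setcompr2 ball_setcompr2_neq conj_assoc
    by (simp only: ev_diff ev_mult[OF act] ev_gen ev_one ev_scalar ev_if right_minus_eq serre not_False_eq_True cong: imp_cong)
qed

end

end

theorem theorem2p4:
  fixes A :: "int^'n^'n::finite" and s :: "'n \<Rightarrow> nat"
    and q :: "'f::{alg_closed_field, field_char_0}"
    and sc :: "'f \<Rightarrow> 'v \<Rightarrow> 'v::ab_group_add" and B :: "'v set"
    and \<sigma> :: "('n borel_gen, 'f) free_alg set \<Rightarrow> 'v \<Rightarrow> 'v"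
    and \<alpha> \<epsilon> :: "'n \<Rightarrow> 'f"
  assumes "affine_gcm A" and "symmetrizing A s"
    and "q \<noteq> 0" and "\<forall>m>0. q ^ m \<noteq> 1"
    and "finite_dimensional_vector_space sc B"
    and "module_structure sc (borel_rels q s A) \<sigma>"
    and "irreducible_structure sc (borel_rels q s A) \<sigma>"
    and "borel_type q s A sc \<sigma> \<alpha>"
    and "\<forall>i. \<epsilon> i \<in> {1, -1}"
  shows "(\<exists>!\<rho>. extends_borel q s A sc \<sigma> \<alpha> \<epsilon> \<rho>) \<and>
         (\<forall>\<rho>. extends_borel q s A sc \<sigma> \<alpha> \<epsilon> \<rho> \<longrightarrow>
            irreducible_structure sc (uq_rels q s A) \<rho> \<and> uq_type q s A sc \<rho> \<epsilon>)"
proof -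
  note fd = assms(5)
  interpret scalars sc
    by (rule scalars.intro[OF finite_dimensional_vector_space.axioms(1)[OF fd]])
  have s: "s i > 0" for i using assms(2) by (simp add: symmetrizing_def)
  have p: "q ^ s i \<noteq> 0" "k > 0 \<Longrightarrow> (q ^ s i) ^ k \<noteq> 1" for i k
    using assms(3,4) s[of i] by (simp_all add: power_mult[symmetric])
  have A: "A $ i $ i = 2" "i \<noteq> j \<Longrightarrow> A $ i $ j \<le> 0" for i j
    using assms(1) by (simp_all add: affine_gcm_def gcm_def)
  have all: "\<forall>i. q ^ s i \<noteq> 0" "\<forall>i. \<forall>k>0. (q ^ s i) ^ k \<noteq> 1" "\<forall>i j. i \<noteq> j \<longrightarrow> A $ i $ j \<le> 0"
    using p A(2) by simp_all
  have \<epsilon>: "\<epsilon> i = 1 \<or> \<epsilon> i = - 1" for i using assms(9) by auto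
  then have \<epsilon>\<epsilon>: "\<epsilon> i * \<epsilon> i = 1" for i by (metis mult_1 square_eq_1_iff)
  then have \<epsilon>\<epsilon>': "\<epsilon> i * (\<epsilon> i * x) = x" for i x by (simp add: mult.assoc[symmetric])

  define act0 where "act0 g = \<sigma> (cls (borel_rels q s A) (gen g))" for g
  have lin0: "lin (act0 g)" for g
    unfolding act0_def by (rule ms_lin[OF assms(6)])
  have rels0: "\<forall>r\<in>borel_rels q s A. \<forall>v. ev act0 r v = 0"
    using ms_relation[OF assms(6)] by (simp add: act0_def[abs_def])
  define e k kinv where "e i = act0 (e_gen i)" and "k i = act0 (k_gen i)" and "kinv i = act0 (kinv_gen i)" for i
  note defs0 = e_def[symmetric] k_def[symmetric] kinv_def[symmetric]
  have lin: "lin (e i)" "lin (k i)" "lin (kinv i)" for i by (simp_all add: e_def k_def kinv_def lin0)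
  note rel0 = rels0[unfolded ev_borel_rels[where q = q and s = s and A = A and act = act0, OF all lin0] defs0]
  have k_kinv: "k i (kinv i v) = v" for i v
    by (rule rel0[THEN conjunct1, THEN spec, THEN spec])
  have kinv_k: "kinv i (k i v) = v" for i v
    by (rule rel0[THEN conjunct2, THEN conjunct1, THEN spec, THEN spec])
  have k_comm: "k i (k j v) = k j (k i v)" for i j v
    by (rule rel0[THEN conjunct2, THEN conjunct2, THEN conjunct1, THEN spec, THEN spec, THEN spec])
  have k_e_kinv: "k i (e j (kinv i v)) = sc ((q ^ s i) powi (A $ i $ j)) (e j v)" for i j v
    by (rule rel0[THEN conjunct2, THEN conjunct2, THEN conjunct2, THEN conjunct1, THEN spec, THEN spec, THEN spec])
  have serre0: "chain (e i) (\<lambda>t. (q ^ s i) powi (2 * int t + A $ i $ j)) (e j)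
      (Suc (nat (- A $ i $ j))) v = 0" if "i \<noteq> j" for i j v
    by (rule rel0[THEN conjunct2, THEN conjunct2, THEN conjunct2, THEN conjunct2, THEN spec, THEN spec,
          THEN mp, OF that, THEN spec])
  have k_e: "k i (e j v) = sc ((q ^ s i) powi (A $ i $ j)) (e j (k i v))" for i j v
    using k_e_kinv[of i j "k i v"] by (simp add: kinv_k)
  have type0: "acts_semisimply sc (k i)" "\<alpha> i \<noteq> 0"
    "\<exists>\<Delta>. \<Delta> \<subseteq> {(q ^ s i) powi m | m. True} \<and> \<Delta> = inverse ` \<Delta> \<and> eigenvalues sc (k i) = (\<lambda>\<theta>. \<alpha> i * \<theta>) ` \<Delta>"
    for i
    using assms(8) by (simp_all add: borel_type_def Let_def k_def act0_def)

  \<comment> \<open>E is already the prescribed E_i, sign included. K and Kinv omit the sign, so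
    that the eigenvalues of K are pure powers of q_i as \<open>borel_operators\<close>
    demands.\<close>
  define E K Kinv where "E i v = sc (\<epsilon> i * inverse (\<alpha> i)) (e i v)"
    and "K i v = sc (inverse (\<alpha> i)) (k i v)" and "Kinv i v = sc (\<alpha> i) (kinv i v)" for i v
  have eE: "e i v = sc (\<alpha> i * \<epsilon> i) (E i v)" and kK: "k i v = sc (\<alpha> i) (K i v)"
    and kinvK: "kinv i v = sc (inverse (\<alpha> i)) (Kinv i v)" for i v
  proof -
    have "\<alpha> i * \<epsilon> i * (\<epsilon> i * inverse (\<alpha> i)) = (\<epsilon> i * \<epsilon> i) * (\<alpha> i * inverse (\<alpha> i))"
      by (simp only: mult_ac)
    then show "e i v = sc (\<alpha> i * \<epsilon> i) (E i v)"
      using type0(2)[of i] \<epsilon>\<epsilon>[of i] by (simp add: E_def)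
    show "k i v = sc (\<alpha> i) (K i v)" "kinv i v = sc (inverse (\<alpha> i)) (Kinv i v)"
      using type0(2)[of i] by (simp_all add: K_def Kinv_def)
  qed
  have linE: "lin (E i)" and linK: "lin (K i)" and linKinv: "lin (Kinv i)" for i
    unfolding E_def[abs_def] K_def[abs_def] Kinv_def[abs_def] by (intro lin_smult lin)+

  \<comment> \<open>Nonzero scalars do not change invariant subspaces, so irreducibility of \<sigma>
    passes to the rescaled operators.\<close>
  have stable_borel: "W = {0} \<or> W = UNIV"
    if W: "module.subspace sc W" and st: "\<And>i. E i ` W \<subseteq> W \<and> K i ` W \<subseteq> W \<and> Kinv i ` W \<subseteq> W" for W
  proof -
    have "act0 g ` W \<subseteq> W" for g
    proof (cases g)
      case (e_gen i)
      then show ?thesis using st[of i] subspace_scale[OF W] by (auto simp: defs0 eE)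
    next
      case (k_gen i)
      then show ?thesis using st[of i] subspace_scale[OF W] by (auto simp: defs0 kK)
    next
      case (kinv_gen i)
      then show ?thesis using st[of i] subspace_scale[OF W] by (auto simp: defs0 kinvK)
    qed
    then have "\<sigma> u ` W \<subseteq> W" if "u \<in> carrier (presented (borel_rels q s A))" for u
      using ms_invariant[OF assms(6) W _ that] by (simp add: act0_def)
    then show ?thesis using assms(7) W by (simp add: irreducible_structure_def)
  qed

  have eigen_K: "v \<noteq> 0 \<Longrightarrow> k i v = sc \<theta> v \<Longrightarrow> \<exists>m. \<theta> = \<alpha> i * (q ^ s i) powi m" for i v \<theta>
  proof -
    assume "v \<noteq> 0" "k i v = sc \<theta> v"
    then have "\<theta> \<in> eigenvalues sc (k i)" by (auto simp: eigenvalues_def)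
    moreover obtain \<Delta> where "\<Delta> \<subseteq> {(q ^ s i) powi m | m. True}"
      "eigenvalues sc (k i) = (\<lambda>\<theta>. \<alpha> i * \<theta>) ` \<Delta>"
      using type0(3)[of i] by (elim exE conjE)
    ultimately show "\<exists>m. \<theta> = \<alpha> i * (q ^ s i) powi m" by auto
  qed
  have wts: "module.span sc (\<Union>b. {v. K i v = sc ((q ^ s i) powi b) v}) = UNIV" for i
  proof -
    have "{v. \<exists>\<theta>. k i v = sc \<theta> v} \<subseteq> (\<Union>b. {v. K i v = sc ((q ^ s i) powi b) v})"
    proof
      fix v assume "v \<in> {v. \<exists>\<theta>. k i v = sc \<theta> v}"
      then obtain \<theta> where \<theta>: "k i v = sc \<theta> v" by blast
      show "v \<in> (\<Union>b. {v. K i v = sc ((q ^ s i) powi b) v})"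
      proof (cases "v = 0")
        case True
        then show ?thesis using lin_0[OF linK] by simp
      next
        case False
        then obtain m where "\<theta> = \<alpha> i * (q ^ s i) powi m" using eigen_K \<theta> by blast
        then have "K i v = sc ((q ^ s i) powi m) v"
          using \<theta> type0(2)[of i] by (simp add: K_def mult.assoc[symmetric])
        then show ?thesis by blast
      qed
    qed
    from span_mono[OF this] show ?thesis
      using type0(1)[of i] by (simp add: acts_semisimply_def top_unique)
  qed
  have sym: "{v. K i v = sc ((q ^ s i) powi (- b)) v} \<noteq> {0}"
    if "{v. K i v = sc ((q ^ s i) powi b) v} \<noteq> {0}" for i b
  proof -
    have eig: "\<alpha> i * \<theta> \<in> eigenvalues sc (k i) \<longleftrightarrow> (\<exists>v. v \<noteq> 0 \<and> K i v = sc \<theta> v)" for \<theta>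
    proof -
      have "k i v = sc (\<alpha> i * \<theta>) v \<longleftrightarrow> K i v = sc \<theta> v" for v
      proof -
        have "k i v = sc (\<alpha> i * \<theta>) v \<longleftrightarrow> sc (\<alpha> i) (K i v) = sc (\<alpha> i) (sc \<theta> v)"
          by (simp add: kK)
        also have "\<dots> \<longleftrightarrow> K i v = sc \<theta> v"
          unfolding scale_cancel_left using type0(2)[of i] by blast
        finally show ?thesis .
      qed
      then show ?thesis by (simp add: eigenvalues_def)
    qed
    obtain \<Delta> where \<Delta>: "\<Delta> = inverse ` \<Delta>" "eigenvalues sc (k i) = (\<lambda>\<theta>. \<alpha> i * \<theta>) ` \<Delta>"
      using type0(3)[of i] by blast
    have mem: "\<alpha> i * \<theta> \<in> eigenvalues sc (k i) \<longleftrightarrow> \<theta> \<in> \<Delta>" for \<theta>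
      using type0(2)[of i] by (auto simp: \<Delta>(2))
    have "0 \<in> {v. K i v = sc ((q ^ s i) powi b) v}" by (simp add: lin_0[OF linK])
    with that obtain v where "v \<noteq> 0" "K i v = sc ((q ^ s i) powi b) v" by blast
    then have "(q ^ s i) powi b \<in> \<Delta>" unfolding mem[symmetric] eig by blast
    then have "inverse ((q ^ s i) powi b) \<in> \<Delta>" by (subst \<Delta>(1)) (rule imageI)
    then have "(q ^ s i) powi (- b) \<in> \<Delta>" by (simp add: power_int_minus)
    then obtain w where "w \<noteq> 0" "K i w = sc ((q ^ s i) powi (- b)) w"
      unfolding mem[symmetric] eig by blast
    then show ?thesis by blast
  qed

  interpret bo: borel_operators sc "\<lambda>i. q ^ s i" "\<lambda>i j. A $ i $ j" K Kinv E
  proof (rule borel_operators.intro[OF scalars_axioms], rule borel_operators_axioms.intro)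
    show "K i (Kinv i v) = v" "Kinv i (K i v) = v" for i v
      using type0(2)[of i] by (simp_all add: K_def Kinv_def lin_scale[OF lin(2)] lin_scale[OF lin(3)] k_kinv kinv_k)
    show "K i (K j v) = K j (K i v)" for i j v
      by (simp add: K_def lin_scale[OF lin(2)] k_comm[of i j] mult.commute)
    show "K i (E j v) = sc ((q ^ s i) powi (A $ i $ j)) (E j (K i v))" for i j v
      by (simp only: K_def E_def lin_scale[OF lin(2)] lin_scale[OF lin(1)] k_e scale_scale mult_ac)
    show "chain (E i) (\<lambda>t. (q ^ s i) powi (2 * int t + A $ i $ j)) (E j) (Suc (nat (- A $ i $ j))) v = 0"
      if "i \<noteq> j" for i j v
      using chain_scale[OF lin(1) lin(1), where v = v] serre0[OF that, of v]
      by (simp only: E_def[abs_def] scale_zero_right)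
    show "(UNIV :: 'v set) \<noteq> {0}" using assms(7) by (simp add: irreducible_structure_def)
    show "\<exists>B. finite B \<and> module.span sc B = UNIV" using finite_dimensional_vector_space.finite_Basis[OF fd]
        finite_dimensional_vector_space.span_Basis[OF fd] by blast
    show "W = {0} \<or> W = UNIV"
      if "module.subspace sc W" "\<And>i. E i ` W \<subseteq> W \<and> K i ` W \<subseteq> W \<and> Kinv i ` W \<subseteq> W" for W
      by (rule stable_borel[OF that])
    show "{v. K i v = sc ((q ^ s i) powi (- b)) v} \<noteq> {0}"
      if "{v. K i v = sc ((q ^ s i) powi b) v} \<noteq> {0}" for i b
      by (rule sym[OF that])
    show "A $ i $ j \<le> 0" if "i \<noteq> j" for i j by (rule A(2)[OF that])
    show "(q ^ s i) ^ k \<noteq> 1" if "k > 0" for i and k :: nat by (rule p(2)[OF that])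
  qed (rule p(1) A(1) linE linK linKinv wts)+

  obtain F where F: "bo.lowering F" using bo.exists_lowering by blast
  note linF = bo.lowering_lin[OF F]
  \<comment> \<open>The sign in front of K multiplies (K - Kinv) / (q_i - 1/q_i) by
    \<open>\<epsilon> i\<close>. As E is prescribed, F has to absorb this sign.\<close>
  define act where "act g = (case g of E_gen i \<Rightarrow> E i | F_gen i \<Rightarrow> (\<lambda>v. sc (\<epsilon> i) (F i v))
      | K_gen i \<Rightarrow> (\<lambda>v. sc (\<epsilon> i) (K i v)) | Kinv_gen i \<Rightarrow> (\<lambda>v. sc (\<epsilon> i) (Kinv i v)))" for g
  have act: "act (E_gen i) = E i" "act (F_gen i) = (\<lambda>v. sc (\<epsilon> i) (F i v))"
    "act (K_gen i) = (\<lambda>v. sc (\<epsilon> i) (K i v))" "act (Kinv_gen i) = (\<lambda>v. sc (\<epsilon> i) (Kinv i v))" for i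
    by (simp_all add: act_def)
  have lin_act: "lin (act g)" for g
    by (cases g) (simp_all add: act linE lin_smult[OF linF] lin_smult[OF linK] lin_smult[OF linKinv])

  \<comment> \<open>Every extension acts on the generators by \<open>act\<close>. Existence,
    uniqueness, irreducibility and type are all drawn from this description.\<close>
  have ext_iff: "extends_borel q s A sc \<sigma> \<alpha> \<epsilon> \<rho> \<longleftrightarrow> module_structure sc (uq_rels q s A) \<rho> \<and>
      (\<forall>g. \<rho> (cls (uq_rels q s A) (gen g)) = act g)" for \<rho>
  proof
    assume ext: "module_structure sc (uq_rels q s A) \<rho> \<and> (\<forall>g. \<rho> (cls (uq_rels q s A) (gen g)) = act g)"
    then show "extends_borel q s A sc \<sigma> \<alpha> \<epsilon> \<rho>"
      by (simp add: extends_borel_def Let_def act E_def K_def Kinv_def e_def k_def kinv_def act0_def)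
  next
    assume "extends_borel q s A sc \<sigma> \<alpha> \<epsilon> \<rho>"
    then have ms: "module_structure sc (uq_rels q s A) \<rho>"
      and gens: "\<And>i v. \<rho> (cls (uq_rels q s A) (gen (E_gen i))) v = act (E_gen i) v"
        "\<And>i v. \<rho> (cls (uq_rels q s A) (gen (K_gen i))) v = act (K_gen i) v"
        "\<And>i v. \<rho> (cls (uq_rels q s A) (gen (Kinv_gen i))) v = act (Kinv_gen i) v"
      by (simp_all add: extends_borel_def Let_def act E_def K_def Kinv_def e_def k_def kinv_def act0_def)
    define act' where "act' g = \<rho> (cls (uq_rels q s A) (gen g))" for g
    have lin': "lin (act' g)" for g unfolding act'_def by (rule ms_lin[OF ms])
    have gens': "act' (E_gen i) = E i" "act' (K_gen i) = (\<lambda>v. sc (\<epsilon> i) (K i v))"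
      "act' (Kinv_gen i) = (\<lambda>v. sc (\<epsilon> i) (Kinv i v))" for i
      using gens by (simp_all add: act'_def fun_eq_iff act)
    have "\<forall>r\<in>uq_rels q s A. \<forall>v. ev act' r v = 0"
      using ms_relation[OF ms] by (simp add: act'_def[abs_def])
    note rel = this[unfolded ev_uq_rels[where q = q and s = s and A = A and act = act', OF all lin'] gens']
    have KF': "sc (\<epsilon> i) (K i (act' (F_gen j) (sc (\<epsilon> i) (Kinv i v)))) =
        sc ((q ^ s i) powi (- A $ i $ j)) (act' (F_gen j) v)" for i j v
      by (rule rel[THEN conjunct2, THEN conjunct2, THEN conjunct2, THEN conjunct2, THEN conjunct1,
            THEN spec, THEN spec, THEN spec])
    have EF': "E i (act' (F_gen i) v) - act' (F_gen i) (E i v) =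
        sc (1 / (q ^ s i - inverse (q ^ s i))) (sc (\<epsilon> i) (K i v) - sc (\<epsilon> i) (Kinv i v))" for i v
      using rel[THEN conjunct2, THEN conjunct2, THEN conjunct2, THEN conjunct2, THEN conjunct2,
          THEN conjunct1, THEN spec, THEN spec, THEN spec, of i i v] by (simp only: refl if_True)
    \<comment> \<open>Since \<open>\<epsilon> i\<close> squares to 1, this removes the sign and
      leaves an operator to which \<open>lowering_unique\<close> applies.\<close>
    define F' where "F' i v = sc (\<epsilon> i) (act' (F_gen i) v)" for i v
    have "bo.lowering F'"
      unfolding bo.lowering_def
    proof (intro allI conjI)
      fix i
      show "lin (F' i)" unfolding F'_def[abs_def] by (rule lin_smult[OF lin'])
      show "K i (F' i v) = sc ((q ^ s i) powi (- 2)) (F' i (K i v))" for v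
      proof -
        have "K i (act' (F_gen i) v) = sc ((q ^ s i) powi (- 2)) (act' (F_gen i) (K i v))"
          using KF'[of i i "K i v"] by (simp add: lin_scale[OF lin'] lin_scale[OF linK] bo.Kinv_K \<epsilon>\<epsilon> A(1))
        then show ?thesis by (simp add: F'_def lin_scale[OF linK] mult.commute)
      qed
      show "E i (F' i v) = F' i (E i v) + bo.bal.H i v" for v
      proof -
        have "E i (F' i v) - F' i (E i v) = sc (\<epsilon> i) (E i (act' (F_gen i) v) - act' (F_gen i) (E i v))"
          by (simp add: F'_def lin_scale[OF linE] scale_right_diff_distrib)
        also have "\<dots> = bo.bal.H i v"
          unfolding EF' scale_right_diff_distrib[symmetric] scale_scale bo.bal.H_def
          using \<epsilon>\<epsilon>[of i] by (simp add: mult_ac)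
        finally show ?thesis by (simp add: algebra_simps)
      qed
    qed
    then have F'F: "F' = F" using F by (rule bo.lowering_unique)
    have "sc (\<epsilon> i) (F' i v) = act' (F_gen i) v" for i v by (simp add: F'_def \<epsilon>\<epsilon>)
    then have "act' (F_gen i) = act (F_gen i)" for i by (simp add: act F'F[symmetric])
    then have "act' g = act g" for g by (cases g) (simp_all add: gens' act)
    then show "module_structure sc (uq_rels q s A) \<rho> \<and> (\<forall>g. \<rho> (cls (uq_rels q s A) (gen g)) = act g)"
      using ms by (simp add: act'_def)
  qed

  have "\<forall>r\<in>uq_rels q s A. \<forall>v. ev act r v = 0"
    unfolding ev_uq_rels[where q = q and s = s and A = A and act = act, OF all lin_act] act
  proof (intro conjI allI impI)
    fix i j v
    show "sc (\<epsilon> i) (K i (sc (\<epsilon> i) (Kinv i v))) = v" "sc (\<epsilon> i) (Kinv i (sc (\<epsilon> i) (K i v))) = v"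
      by (simp_all add: lin_scale[OF linK] lin_scale[OF linKinv] \<epsilon>\<epsilon> bo.K_Kinv bo.Kinv_K)
    show "sc (\<epsilon> i) (K i (sc (\<epsilon> j) (K j v))) = sc (\<epsilon> j) (K j (sc (\<epsilon> i) (K i v)))"
      by (simp add: lin_scale[OF linK] bo.K_comm[of i j] mult.commute)
    show "sc (\<epsilon> i) (K i (E j (sc (\<epsilon> i) (Kinv i v)))) = sc ((q ^ s i) powi (A $ i $ j)) (E j v)"
      by (simp add: lin_scale[OF linE] lin_scale[OF linK] \<epsilon>\<epsilon> bo.K_E bo.K_Kinv)
    show "sc (\<epsilon> i) (K i (sc (\<epsilon> j) (F j (sc (\<epsilon> i) (Kinv i v))))) =
        sc ((q ^ s i) powi (- A $ i $ j)) (sc (\<epsilon> j) (F j v))"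
      by (simp add: lin_scale[OF linF] lin_scale[OF linK] bo.lowering_K_other[OF F] bo.K_Kinv mult_ac \<epsilon>\<epsilon>')
    show "E i (sc (\<epsilon> j) (F j v)) - sc (\<epsilon> j) (F j (E i v)) =
        (if i = j then sc (1 / (q ^ s i - inverse (q ^ s i))) (sc (\<epsilon> i) (K i v) - sc (\<epsilon> i) (Kinv i v)) else 0)"
    proof (cases "i = j")
      case True
      have "E i (sc (\<epsilon> i) (F i v)) - sc (\<epsilon> i) (F i (E i v)) = sc (\<epsilon> i) (bo.bal.H i v)"
        by (simp add: lin_scale[OF linE] bo.lowering_E[OF F] scale_right_distrib)
      then show ?thesis
        unfolding bo.bal.H_def True by (simp add: scale_right_diff_distrib mult.commute)
    next
      case False
      then show ?thesis using bo.lowering_E_other[OF F, of j i v] by (simp add: lin_scale[OF linE])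
    qed
    assume ij: "i \<noteq> j"
    show "chain (E i) (\<lambda>t. (q ^ s i) powi (2 * int t + A $ i $ j)) (E j) (Suc (nat (- A $ i $ j))) v = 0"
      by (rule bo.serre[OF ij])
    show "chain (\<lambda>v. sc (\<epsilon> i) (F i v)) (\<lambda>t. (q ^ s i) powi (2 * int t + A $ i $ j)) (\<lambda>v. sc (\<epsilon> j) (F j v))
        (Suc (nat (- A $ i $ j))) v = 0"
      unfolding chain_scale[OF linF linF] bo.lowering_serre[OF F ij] by simp
  qed
  then obtain \<rho> where \<rho>: "module_structure sc (uq_rels q s A) \<rho>"
      "\<And>g. \<rho> (cls (uq_rels q s A) (gen g)) = act g"
    using exists_module_structure[where act = act, OF lin_act, of "uq_rels q s A"] by blast
  have ex1: "\<exists>!\<rho>. extends_borel q s A sc \<sigma> \<alpha> \<epsilon> \<rho>"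
  proof (rule ex1I[of _ \<rho>])
    show "extends_borel q s A sc \<sigma> \<alpha> \<epsilon> \<rho>" using \<rho> by (simp add: ext_iff)
    show "\<rho>' = \<rho>" if "extends_borel q s A sc \<sigma> \<alpha> \<epsilon> \<rho>'" for \<rho>'
      using that \<rho> by (intro module_structure_unique[of "uq_rels q s A"]) (simp_all add: ext_iff)
  qed
  have "irreducible_structure sc (uq_rels q s A) \<rho>' \<and> uq_type q s A sc \<rho>' \<epsilon>"
    if "extends_borel q s A sc \<sigma> \<alpha> \<epsilon> \<rho>'" for \<rho>'
  proof
    have gens: "\<rho>' (cls (uq_rels q s A) (gen g)) = act g" for g using that by (simp add: ext_iff)
    show "irreducible_structure sc (uq_rels q s A) \<rho>'"
      unfolding irreducible_structure_def
    proof (intro conjI allI impI)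
      show "(UNIV :: 'v set) \<noteq> {0}" by (rule bo.nz)
      fix W assume W: "module.subspace sc W \<and> (\<forall>u\<in>carrier (presented (uq_rels q s A)). \<rho>' u ` W \<subseteq> W)"
      then have st: "act g ` W \<subseteq> W" for g using gens cls_carrier by metis
      have K: "K i v = sc (\<epsilon> i) (act (K_gen i) v)" "Kinv i v = sc (\<epsilon> i) (act (Kinv_gen i) v)" for i v
        by (simp_all add: act \<epsilon>\<epsilon>)
      show "W = {0} \<or> W = UNIV"
      \<comment> \<open>A U_q-submodule is stable under the operators that come from the Borel
        action, which is irreducible.\<close>
      proof (rule stable_borel)
        show "module.subspace sc W" using W by blast
        then show "E i ` W \<subseteq> W \<and> K i ` W \<subseteq> W \<and> Kinv i ` W \<subseteq> W" for i
          using st[of "E_gen i"] st[of "K_gen i"] st[of "Kinv_gen i"] subspace_scale[of W]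
          by (auto simp: K act(1) simp del: act(3,4))
      qed
    qed
    show "uq_type q s A sc \<rho>' \<epsilon>"
      unfolding uq_type_def Let_def gens act
    proof (intro allI conjI)
      fix i
      show "\<epsilon> i \<in> {1, - 1}" using \<epsilon> by blast
      have "(\<Union>b. {v. K i v = sc ((q ^ s i) powi b) v}) \<subseteq> {v. \<exists>\<theta>. sc (\<epsilon> i) (K i v) = sc \<theta> v}"
        by auto
      from span_mono[OF this] show "acts_semisimply sc (\<lambda>v. sc (\<epsilon> i) (K i v))"
        by (simp add: acts_semisimply_def wts top_unique)
      show "eigenvalues sc (\<lambda>v. sc (\<epsilon> i) (K i v)) \<subseteq> {\<epsilon> i * (q ^ s i) powi m | m. True}"
      proof
        fix \<theta> assume "\<theta> \<in> eigenvalues sc (\<lambda>v. sc (\<epsilon> i) (K i v))"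
        then obtain v where v: "v \<noteq> 0" "sc (\<epsilon> i) (K i v) = sc \<theta> v" by (auto simp: eigenvalues_def)
        have "K i v = sc (\<epsilon> i) (sc (\<epsilon> i) (K i v))" by (simp add: \<epsilon>\<epsilon>)
        then have "k i v = sc (\<alpha> i * (\<epsilon> i * \<theta>)) v" by (simp add: v(2) kK)
        from eigen_K[OF v(1) this] obtain m where "\<alpha> i * (\<epsilon> i * \<theta>) = \<alpha> i * (q ^ s i) powi m" by blast
        then have "\<epsilon> i * \<theta> = (q ^ s i) powi m" using type0(2)[of i] by simp
        then have "\<theta> = \<epsilon> i * (q ^ s i) powi m" using \<epsilon>\<epsilon>'[of i \<theta>] by simp
        then show "\<theta> \<in> {\<epsilon> i * (q ^ s i) powi m | m. True}" by blast
      qed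
    qed
  qed
  with ex1 show ?thesis by blast
qed

end
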